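(* Let $\mathcal{R}$ be the 2-dimensional Radon transform and $\mathcal{R}^\ast$ its adjoint, $$\mathcal{R}f(s,\omega)=\int_{\omega\cdot x=s}f(x)\,dL(x),\quad (s,\omega)\in\mathbb{R}\times\mathbb{S}^1;\qquad \mathcal{R}^\ast G(x)=\int_{\mathbb{S}^1}G(x\cdot\omega,\omega)\,d\omega,\quad x\in\mathbb{R}^2.$$ There is an absolute constant $C>0$ such that the following hold. (a) Let $b>a>0$ with $b/a\le2$. If $G\in L^2(\mathbb{R}\times\mathbb{S}^1)$ is supported in $([-b,-a]\cup[a,b])\times\mathbb{S}^1$, then $$\int_{|x|>R}|\mathcal{R}^\ast G(x)|^4\,dx\le C\,\frac{(a/R)(1-a/b)}{(1-a/R)^{1/2}}\,\|G\|_{L^2(\mathbb{R}\times\mathbb{S}^1)}^4\quad\text{for all }R>b,$$ $$\int_{\mathbb{R}^2}|\mathcal{R}^\ast G(x)|^4\,dx\le C\,(1-a/b)^{1/2}\,\|G\|_{L^2(\mathbb{R}\times\mathbb{S}^1)}^4.$$ (b) Let $R\ge b>0$. If $G\in L^2(\mathbb{R}\times\mathbb{S}^1)$ is supported in $[-b,b]\times\mathbb{S}^1$, then $$\int_{|x|>R}|\mathcal{R}^\ast G(x)|^4\,dx\le C\,\frac{b}{R}\,\|G\|_{L^2(\mathbb{R}\times\mathbb{S}^1)}^4.$$ (c) Let $R\ge b>0$. If $f\in L^{4/3}(\mathbb{R}^2)$ and $f(x)=0$ for all $|x|<R$, then $$\|\mathcal{R}f\|_{L^2([-b,b]\times\mathbb{S}^1)}\le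 C\,(b/R)^{1/4}\,\|f\|_{L^{4/3}(\mathbb{R}^2)}.$$
   Context: $\mathbb{S}^1$ is the unit circle in $\mathbb{R}^2$ with arc-length measure $d\omega$; $dL$ is the line (length) measure on a straight line in $\mathbb{R}^2$. $L^2(\mathbb{R}\times\mathbb{S}^1)$ is taken with respect to $ds\,d\omega$. $\mathcal{R}f$ and $\mathcal{R}^\ast G$ are understood almost everywhere (as extensions by continuity from nice functions). *)

theory Defs
  imports "HOL-Analysis.Analysis"
begin

text \<open>
  Length measure on a curve \<open>S\<close> that is parametrised injectively and with unit speed by
  \<open>\<gamma>\<close> on \<open>I\<close>. It is completed, so that functions that are only
  Lebesgue measurable can be integrated over curves.
\<close>

definition length_measure :: "(real^2) set \<Rightarrow> real set \<Rightarrow> (real \<Rightarrow> real^2) \<Rightarrow> (real^2) measure" where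
  "length_measure S I \<gamma> =
     completion (distr (restrict_space lborel I) (restrict_space borel S) \<gamma>)"

definition circle_measure :: "(real^2) measure" where
  "circle_measure = length_measure (sphere 0 1) {0..<2 * pi} (\<lambda>t. vector [cos t, sin t])"

definition perp :: "real^2 \<Rightarrow> real^2" where
  "perp \<omega> = vector [- \<omega> $ 2, \<omega> $ 1]"

text \<open>Meaningful only for unit vectors \<open>\<omega>\<close>: then \<open>perp \<omega>\<close> is a unit direction vector of the line.\<close>

definition line_measure :: "real \<Rightarrow> real^2 \<Rightarrow> (real^2) measure" where
  "line_measure s \<omega> =
     length_measure {x. \<omega> \<bullet> x = s} UNIV (\<lambda>t. s *\<^sub>R \<omega> + t *\<^sub>R perp \<omega>)"

text \<open>The measure \<open>ds d\<omega>\<close> on \<open>\<real> \<times> S\<^sup>1\<close>.\<close>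

definition cylinder_measure :: "(real \<times> (real^2)) measure" where
  "cylinder_measure = completion (lborel \<Otimes>\<^sub>M circle_measure)"

text \<open>
  Functions rather than classes modulo null sets. Both transforms below send functions that agree
  almost everywhere to functions that agree almost everywhere.
\<close>

definition Lp :: "'a measure \<Rightarrow> real \<Rightarrow> ('a \<Rightarrow> complex) set" where
  "Lp M p = {f \<in> borel_measurable M. integrable M (\<lambda>x. norm (f x) powr p)}"

definition Lp_norm :: "'a measure \<Rightarrow> real \<Rightarrow> ('a \<Rightarrow> complex) \<Rightarrow> real" where
  "Lp_norm M p f = (LINT x|M. norm (f x) powr p) powr (1 / p)"

text \<open>
  Bochner integrals have the default value 0 where the integrand is not integrable, so statements
  about the two transforms have to assert integrability for almost every argument. Given this,
  linearity and a norm bound make them coincide with the extension by continuity from nice functions.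
\<close>

definition radon :: "(real^2 \<Rightarrow> complex) \<Rightarrow> real \<times> (real^2) \<Rightarrow> complex" where
  "radon f = (\<lambda>(s, \<omega>). LINT x|line_measure s \<omega>. f x)"

definition radon_adj :: "(real \<times> (real^2) \<Rightarrow> complex) \<Rightarrow> real^2 \<Rightarrow> complex" where
  "radon_adj G x = (LINT \<omega>|circle_measure. G (x \<bullet> \<omega>, \<omega>))"

end

theory Submission
  imports Defs
begin

text \<open>
  Everything rests on one quantity: for \<open>S \<subseteq> \<real>\<close> and a point \<open>x\<close> of the plane, the length
  \<open>|{\<omega>. x \<bullet> \<omega> \<in> S}|\<close> of the set of directions whose line through \<open>x\<close> has its offset in \<open>S\<close>.
  If it is at most \<open>A\<close> for all \<open>x\<close> in a set \<open>E\<close>, then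

    \<^item> the Radon transform maps \<open>L\<^sup>4\<^sup>/\<^sup>3(E)\<close> to \<open>L\<^sup>2(S \<times> S\<^sup>1)\<close> with norm \<open>O(A\<^sup>1\<^sup>/\<^sup>4)\<close>, and
    \<^item> its adjoint maps \<open>L\<^sup>2(S \<times> S\<^sup>1)\<close> to \<open>L\<^sup>4(E)\<close> with the same norm.

  All three parts of the theorem are instances; they differ only in the bound for the length of arcs.

  The reason for the first bound: \<open>\<integral>\<^bsub>S \<times> S\<^sup>1\<^esub> (\<R>f)\<^sup>2\<close> is the integral over \<open>\<omega>\<close>, over \<open>s \<in> S\<close> and over pairs of
  points \<open>x\<close>, \<open>y = x + u perp \<omega>\<close> on the line \<open>(s, \<omega>)\<close> of \<open>f(x) f(y)\<close>. As \<open>|u| du d\<omega>\<close> is comparable to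
  \<open>dy\<close>, this is a Hardy-Littlewood-Sobolev form with the kernel \<open>1/|x - y|\<close>, cut off to the pairs whose
  line is in \<open>S\<close>; for fixed \<open>x\<close> the kernel has weak \<open>L\<^sup>2\<close> norm about \<open>A\<^sup>1\<^sup>/\<^sup>2\<close>. Maximal functions and
  interpolation can be avoided. Put \<open>f = h\<^sup>3\<close>, \<open>X = h(x)\<close>, \<open>Y = h(y)\<close>. If \<open>Y \<le> X\<close>, then near \<open>x\<close>, that
  is for \<open>\<kappa> |u| X\<^sup>2 \<le> 1\<close>, one bounds \<open>X\<^sup>3 Y\<^sup>3\<close> by \<open>X\<^sup>6\<close>, and far from \<open>x\<close> by
  \<open>\<kappa> |u| X\<^sup>4 Y\<^sup>4 + (\<kappa> |u|)\<^sup>-\<^sup>3\<close>. The first term integrates to \<open>\<kappa> N\<^sup>2\<close> with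
  \<open>N = \<integral> h\<^sup>4 = \<integral> f\<^sup>4\<^sup>/\<^sup>3\<close>, by polar coordinates about \<open>x\<close>. The other two are functions of \<open>x\<close> and \<open>u\<close>
  only, with integral over \<open>u\<close> about \<open>X\<^sup>4 / \<kappa>\<close>, and give \<open>A N / \<kappa>\<close>. The choice \<open>\<kappa> = (A / N)\<^sup>1\<^sup>/\<^sup>2\<close>
  balances them, and the result is \<open>A\<^sup>1\<^sup>/\<^sup>2 N\<^sup>3\<^sup>/\<^sup>2\<close>. The lemmas \<open>cube_mult_cube_le\<close>,
  \<open>nn_radon_cube_square_le\<close> and \<open>nn_radon_L2_le\<close> carry this argument out.

  The bound for the adjoint follows by testing against the cube of a truncation of the adjoint itself
  (\<open>nn_radon_adj_L4_le\<close>), through the duality \<open>nn_radon_duality\<close>. The same duality, applied to indicators of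
  null sets, shows that both transforms respect equality almost everywhere. This reduces the statements for
  complex-valued functions that are only measurable for the completed measures to the estimates for
  nonnegative functions.
\<close>

section \<open>Coordinates in the plane\<close>

lemma vector_2_expand: "(vector [x, y] :: real^2) = x *\<^sub>R axis 1 1 + y *\<^sub>R axis 2 1"
  by (simp add: vec_eq_iff forall_2 axis_def)

lemma borel_measurable_vector_2 [measurable]:
  assumes "f \<in> borel_measurable M" "g \<in> borel_measurable M"
  shows "(\<lambda>x. vector [f x, g x] :: real^2) \<in> borel_measurable M"
  unfolding vector_2_expand using assms by measurable

lemma borel_measurable_perp [measurable]: "perp \<in> borel_measurable borel"
  unfolding perp_def by measurable

lemma lborel_plane: "(lborel :: (real^2) measure) = distr (lborel \<Otimes>\<^sub>M lborel) borel (\<lambda>(x, y). vector [x, y])"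
proof (rule lborel_eqI)
  fix l u :: "real^2"
  assume le: "\<And>b. b \<in> Basis \<Longrightarrow> l \<bullet> b \<le> u \<bullet> b"
  have le1: "l $ 1 \<le> u $ 1" and le2: "l $ 2 \<le> u $ 2"
    using le[of "axis 1 1"] le[of "axis 2 1"] by (auto simp: inner_axis Basis_vec_def)
  have B: "(Basis :: (real^2) set) = {axis 1 1, axis 2 1}"
    by (auto simp: Basis_vec_def UNIV_2)
  have "(\<lambda>(x, y). vector [x, y] :: real^2) -` box l u \<inter> space (lborel \<Otimes>\<^sub>M lborel)
        = {l $ 1<..<u $ 1} \<times> {l $ 2<..<u $ 2}"
    by (auto simp: space_pair_measure mem_box_cart forall_2)
  then have "emeasure (distr (lborel \<Otimes>\<^sub>M lborel) borel (\<lambda>(x, y). vector [x, y])) (box l u)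
      = emeasure (lborel \<Otimes>\<^sub>M lborel) ({l $ 1<..<u $ 1} \<times> {l $ 2<..<u $ 2})"
    by (subst emeasure_distr) auto
  also have "\<dots> = (u $ 1 - l $ 1) * (u $ 2 - l $ 2)"
    using le1 le2 by (subst lborel.emeasure_pair_measure_Times) (auto simp: ennreal_mult)
  also have "\<dots> = (\<Prod>b\<in>Basis. (u - l) \<bullet> b)"
    by (simp add: B axis_eq_axis inner_axis)
  finally show "emeasure (distr (lborel \<Otimes>\<^sub>M lborel) borel (\<lambda>(x, y). vector [x, y])) (box l u)
      = ennreal (\<Prod>b\<in>Basis. (u - l) \<bullet> b)" .
qed simp

text \<open>
  Rotations and polar coordinates are obtained below from affine substitutions in one variable and the
  substitution of a tangent, once integrals over the plane are iterated integrals.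
\<close>

lemma nn_integral_plane:
  fixes F :: "real^2 \<Rightarrow> ennreal"
  assumes [measurable]: "F \<in> borel_measurable borel"
  shows "(\<integral>\<^sup>+x. F x \<partial>lborel) = (\<integral>\<^sup>+x. (\<integral>\<^sup>+y. F (vector [x, y]) \<partial>lborel) \<partial>lborel)"
  by (subst lborel_plane)
    (simp add: nn_integral_distr lborel.nn_integral_fst[symmetric] case_prod_beta)

lemma nn_integral_plane_swap:
  fixes F :: "real^2 \<Rightarrow> ennreal"
  assumes [measurable]: "F \<in> borel_measurable borel"
  shows "(\<integral>\<^sup>+x. F x \<partial>lborel) = (\<integral>\<^sup>+y. (\<integral>\<^sup>+x. F (vector [x, y]) \<partial>lborel) \<partial>lborel)"
  unfolding nn_integral_plane[OF assms] by (rule lborel_pair.Fubini') simp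

lemma unit_vector_2:
  assumes "norm (\<omega> :: real^2) = 1"
  shows "(\<omega> $ 1)\<^sup>2 + (\<omega> $ 2)\<^sup>2 = 1"
  using assms by (simp add: norm_eq_1 inner_vec_def sum_2 power2_eq_square)

text \<open>
  For fixed \<open>t\<close> the first coordinate is an affine function of \<open>s\<close>, and for a fixed first coordinate the
  second one is an affine function of \<open>t\<close>. The two Jacobians are inverse to each other. The directions with
  \<open>\<omega> $ 1 = 0\<close>, for which the first substitution degenerates, form a null set of the circle.
\<close>

lemma nn_integral_rotate:
  fixes F :: "real^2 \<Rightarrow> ennreal"
  assumes [measurable]: "F \<in> borel_measurable borel" and "norm \<omega> = 1" and nz: "\<omega> $ 1 \<noteq> 0"
  shows "(\<integral>\<^sup>+s. (\<integral>\<^sup>+t. F (s *\<^sub>R \<omega> + t *\<^sub>R perp \<omega>) \<partial>lborel) \<partial>lborel) = (\<integral>\<^sup>+x. F x \<partial>lborel)"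
proof -
  define c d where "c = \<omega> $ 1" and "d = \<omega> $ 2"
  have cd: "c\<^sup>2 + d\<^sup>2 = 1" and c: "c \<noteq> 0"
    using unit_vector_2[OF assms(2)] nz by (auto simp: c_def d_def)
  have "s *\<^sub>R \<omega> + t *\<^sub>R perp \<omega> = vector [c * s - d * t, d * s + c * t]" for s t
    by (simp add: vec_eq_iff forall_2 perp_def c_def d_def)
  then have "(\<integral>\<^sup>+s. (\<integral>\<^sup>+t. F (s *\<^sub>R \<omega> + t *\<^sub>R perp \<omega>) \<partial>lborel) \<partial>lborel)
      = (\<integral>\<^sup>+s. (\<integral>\<^sup>+t. F (vector [c * s - d * t, d * s + c * t]) \<partial>lborel) \<partial>lborel)"
    by simp
  also have "\<dots> = (\<integral>\<^sup>+t. (\<integral>\<^sup>+s. F (vector [c * s - d * t, d * s + c * t]) \<partial>lborel) \<partial>lborel)"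
    by (rule lborel_pair.Fubini') simp
  also have "\<dots> = (\<integral>\<^sup>+t. \<bar>1 / c\<bar> * (\<integral>\<^sup>+p. F (vector [p, d / c * p + t / c]) \<partial>lborel) \<partial>lborel)"
  proof (rule nn_integral_cong)
    fix t
    have "d * (d / c * t + 1 / c * p) + c * t = d / c * p + (c\<^sup>2 + d\<^sup>2) * (t / c)" for p
      using c by (simp add: field_simps power2_eq_square)
    moreover have "c * (d / c * t + 1 / c * p) - d * t = p" for p
      using c by (simp add: field_simps)
    ultimately show "(\<integral>\<^sup>+s. F (vector [c * s - d * t, d * s + c * t]) \<partial>lborel)
        = \<bar>1 / c\<bar> * (\<integral>\<^sup>+p. F (vector [p, d / c * p + t / c]) \<partial>lborel)"
      using c cd by (subst nn_integral_real_affine[of _ "1 / c" "d / c * t"]) simp_all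
  qed
  also have "\<dots> = \<bar>1 / c\<bar> * (\<integral>\<^sup>+p. (\<integral>\<^sup>+t. F (vector [p, d / c * p + t / c]) \<partial>lborel) \<partial>lborel)"
    by (subst nn_integral_cmult, measurable, subst lborel_pair.Fubini') simp_all
  also have "\<dots> = \<bar>1 / c\<bar> * (\<integral>\<^sup>+p. \<bar>c\<bar> * (\<integral>\<^sup>+q. F (vector [p, q]) \<partial>lborel) \<partial>lborel)"
  proof -
    have "(\<integral>\<^sup>+t. F (vector [p, d / c * p + t / c]) \<partial>lborel) = \<bar>c\<bar> * (\<integral>\<^sup>+q. F (vector [p, q]) \<partial>lborel)" for p
      using c by (subst nn_integral_real_affine[of _ c "- d * p"]) (simp_all add: field_simps)
    then show ?thesis by simp
  qed
  also have "\<dots> = (\<integral>\<^sup>+x. F x \<partial>lborel)"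
    using c by (simp add: nn_integral_cmult nn_integral_plane mult.assoc[symmetric] ennreal_mult[symmetric])
  finally show ?thesis .
qed

text \<open>
  The tangent maps \<open>dt / cos\<^sup>2 t\<close> on an open half period to Lebesgue measure. It is enough to compare the
  two measures on intervals, where this is the fundamental theorem of calculus.
\<close>

lemma lborel_tan:
  "(lborel :: real measure) =
     distr (density lborel (\<lambda>t. ennreal (indicator {-pi/2<..<pi/2} t / (cos t)\<^sup>2))) borel tan"
proof (rule lborel_eqI)
  fix l u :: real
  assume "\<And>b. b \<in> Basis \<Longrightarrow> l \<bullet> b \<le> u \<bullet> b"
  then have "l \<le> u" by simp
  have tan_iff: "(l < tan t \<and> tan t < u) \<longleftrightarrow> t \<in> {arctan l<..<arctan u}" if "t \<in> {-pi/2<..<pi/2}" for t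
    using that by (metis arctan_less_iff arctan_tan greaterThanLessThan_iff minus_divide_left)
  have Ioo: "{arctan l..arctan u} \<subseteq> {-pi/2<..<pi/2}"
    using arctan_lbound[of l] arctan_ubound[of u] by auto
  have [measurable]: "(tan :: real \<Rightarrow> real) \<in> borel_measurable borel"
    unfolding tan_def by measurable
  have "emeasure (distr (density lborel (\<lambda>t. ennreal (indicator {-pi/2<..<pi/2} t / (cos t)\<^sup>2))) borel tan) (box l u)
     = (\<integral>\<^sup>+t. ennreal (indicator {-pi/2<..<pi/2} t / (cos t)\<^sup>2) * indicator (tan -` box l u) t \<partial>lborel)"
  proof -
    have "tan -` {l<..<u} \<in> sets (borel :: real measure)"
      using measurable_sets[of tan borel borel "{l<..<u}"] by simp
    then have T: "tan -` {l<..<u} \<in> sets lborel" by simp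
    show ?thesis
      by (subst emeasure_distr) (simp_all add: emeasure_density[OF _ T])
  qed
  also have "\<dots> = (\<integral>\<^sup>+t. ennreal (1 / (cos t)\<^sup>2) * indicator {arctan l..arctan u} t \<partial>lborel)"
  proof (rule nn_integral_cong_AE)
    show "AE t in lborel. ennreal (indicator {-pi/2<..<pi/2} t / (cos t)\<^sup>2) * indicator (tan -` box l u) t
        = ennreal (1 / (cos t)\<^sup>2) * indicator {arctan l..arctan u} t"
      using AE_lborel_singleton[of "arctan l"] AE_lborel_singleton[of "arctan u"]
    proof eventually_elim
      case (elim t)
      then show ?case
        using tan_iff[of t] Ioo by (cases "t \<in> {-pi/2<..<pi/2}") (auto simp: indicator_def box_real)
    qed
  qed
  also have "\<dots> = tan (arctan u) - tan (arctan l)"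
  proof (rule nn_integral_FTC_Icc)
    show "DERIV tan x :> 1 / (cos x)\<^sup>2" if "x \<in> {arctan l..arctan u}" for x
      using that Ioo cos_gt_zero_pi[of x]
      by (force intro!: derivative_eq_intros simp: inverse_eq_divide)
  qed (use \<open>l \<le> u\<close> in \<open>auto simp: arctan_le_iff\<close>)
  also have "\<dots> = ennreal (\<Prod>b\<in>Basis. (u - l) \<bullet> b)" by (simp add: tan_arctan)
  finally show "emeasure (distr (density lborel (\<lambda>t. ennreal (indicator {-pi/2<..<pi/2} t / (cos t)\<^sup>2))) borel tan) (box l u)
      = ennreal (\<Prod>b\<in>Basis. (u - l) \<bullet> b)" .
qed simp

lemma nn_integral_tan:
  fixes g :: "real \<Rightarrow> ennreal"
  assumes [measurable]: "g \<in> borel_measurable borel"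
  shows "(\<integral>\<^sup>+t. ennreal (indicator {-pi/2<..<pi/2} t / (cos t)\<^sup>2) * g (tan t) \<partial>lborel) = (\<integral>\<^sup>+m. g m \<partial>lborel)"
proof -
  have [measurable]: "(tan :: real \<Rightarrow> real) \<in> borel_measurable borel"
    unfolding tan_def by measurable
  show ?thesis
    by (subst (2) lborel_tan) (simp add: nn_integral_distr nn_integral_density)
qed

lemma nn_integral_inverse_1_plus_square: "(\<integral>\<^sup>+m. ennreal (1 / (1 + m\<^sup>2)) \<partial>(lborel :: real measure)) = pi"
proof -
  have "ennreal (indicator {-pi/2<..<pi/2} t / (cos t)\<^sup>2) * ennreal (1 / (1 + (tan t)\<^sup>2))
      = indicator {-pi/2<..<pi/2} t" for t :: real
  proof (cases "t \<in> {-pi/2<..<pi/2}")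
    case True
    then have "cos t \<noteq> 0" using cos_gt_zero_pi[of t] by auto
    then have "1 / (cos t)\<^sup>2 * (1 / (1 + (tan t)\<^sup>2)) = 1"
      by (simp add: tan_sec inverse_eq_divide power_divide)
    then show ?thesis using True by (simp add: ennreal_mult[symmetric])
  qed simp
  then show ?thesis
    by (subst nn_integral_tan[symmetric]) simp_all
qed

section \<open>Integration over the circle and polar coordinates\<close>

lemma space_circle_measure [simp]: "space circle_measure = sphere 0 1"
  by (simp add: circle_measure_def length_measure_def space_restrict_space)

lemma circle_param_measurable:
  "(\<lambda>t. vector [cos t, sin t] :: real^2) \<in>
     restrict_space lborel {0..<2 * pi} \<rightarrow>\<^sub>M restrict_space borel (sphere 0 1)"
proof (rule measurable_restrict_space2)
  show "(\<lambda>t. vector [cos t, sin t] :: real^2) \<in> space (restrict_space lborel {0..<2 * pi}) \<rightarrow> sphere 0 1"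
    by (auto simp: norm_eq_1 inner_vec_def sum_2 power2_eq_square[symmetric])
  show "(\<lambda>t. vector [cos t, sin t] :: real^2) \<in> borel_measurable (restrict_space lborel {0..<2 * pi})"
    by (rule measurable_restrict_space1) measurable
qed

lemma measurable_ident_circle: "(\<lambda>\<omega>. \<omega>) \<in> circle_measure \<rightarrow>\<^sub>M borel"
  unfolding circle_measure_def length_measure_def
  by (rule measurable_completion, subst measurable_distr_eq1, rule measurable_restrict_space1) simp

lemma borel_measurable_circle:
  "F \<in> borel_measurable borel \<Longrightarrow> F \<in> borel_measurable circle_measure"
  using measurable_compose[OF measurable_ident_circle] by blast

lemma nn_integral_circle:
  fixes F :: "real^2 \<Rightarrow> ennreal"
  assumes [measurable]: "F \<in> borel_measurable borel"
  shows "(\<integral>\<^sup>+\<omega>. F \<omega> \<partial>circle_measure)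
       = (\<integral>\<^sup>+t. indicator {0..<2 * pi} t * F (vector [cos t, sin t]) \<partial>lborel)"
proof -
  have "(\<integral>\<^sup>+\<omega>. F \<omega> \<partial>circle_measure) = (\<integral>\<^sup>+t. F (vector [cos t, sin t]) \<partial>restrict_space lborel {0..<2 * pi})"
    unfolding circle_measure_def length_measure_def nn_integral_completion
    by (rule nn_integral_distr[OF circle_param_measurable]) (simp add: measurable_restrict_space1)
  then show ?thesis
    by (simp add: nn_integral_restrict_space mult.commute)
qed

lemma emeasure_circle:
  assumes [measurable]: "B \<in> sets borel"
  shows "emeasure circle_measure (B \<inter> sphere 0 1)
       = emeasure lborel {t \<in> {0..<2 * pi}. vector [cos t, sin t] \<in> B}"
proof -
  have "B \<inter> sphere 0 1 \<in> sets circle_measure"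
    using measurable_sets[OF measurable_ident_circle assms] by simp
  then have "emeasure circle_measure (B \<inter> sphere 0 1) = (\<integral>\<^sup>+\<omega>. indicator (B \<inter> sphere 0 1) \<omega> \<partial>circle_measure)"
    by simp
  also have "\<dots> = (\<integral>\<^sup>+\<omega>. indicator B \<omega> \<partial>circle_measure)"
    by (rule nn_integral_cong) (simp add: indicator_def)
  also have "\<dots> = (\<integral>\<^sup>+t. indicator {t \<in> {0..<2 * pi}. vector [cos t, sin t] \<in> B} t \<partial>lborel)"
    by (subst nn_integral_circle, simp, intro nn_integral_cong) (auto simp: indicator_def)
  finally show ?thesis by simp
qed

lemma emeasure_circle_space: "emeasure circle_measure (sphere 0 1) = 2 * pi"
  using emeasure_circle[of UNIV] by (simp flip: atLeastLessThan_iff)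

interpretation circle: finite_measure circle_measure
  by (rule finite_measureI) (simp add: emeasure_circle_space)

interpretation lborel_circle: pair_sigma_finite lborel circle_measure ..

lemma AE_cos_nonzero: "AE t in lborel. cos (t :: real) \<noteq> 0"
proof -
  have "{t. cos (t :: real) = 0} \<subseteq> range (\<lambda>i::int. of_int i * (pi / 2))"
    by (auto simp: cos_zero_iff_int)
  then have "countable {t. cos (t :: real) = 0}"
    by (rule countable_subset) simp
  then show ?thesis
    using countable_imp_null_set_lborel AE_not_in by fastforce
qed

lemma AE_circle_fst_nonzero: "AE \<omega> in circle_measure. \<omega> $ 1 \<noteq> 0"
proof -
  have "(\<integral>\<^sup>+\<omega>. indicator {\<omega>. \<omega> $ 1 = 0} \<omega> \<partial>circle_measure) = (\<integral>\<^sup>+t. 0 \<partial>(lborel :: real measure))"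
    by (subst nn_integral_circle, simp, rule nn_integral_cong_AE)
       (use AE_cos_nonzero in \<open>auto elim!: eventually_mono simp: indicator_def\<close>)
  then have "AE \<omega> in circle_measure. indicator {\<omega>. \<omega> $ 1 = 0} \<omega> = (0::ennreal)"
    using nn_integral_0_iff_AE[of "indicator {\<omega>. \<omega> $ 1 = 0}" circle_measure]
    by (simp add: borel_measurable_circle)
  then show ?thesis by (auto elim!: eventually_mono simp: indicator_def)
qed

text \<open>
  The slope \<open>\<omega> $ 2 / \<omega> $ 1\<close> is the tangent of the angle. The interval \<open>{0..<2 * pi}\<close> meets three translates
  of the half period on which the tangent is injective. The sharp factor is 2, but covering by three
  translates saves cutting and reassembling intervals.
\<close>

lemma nn_integral_circle_slope_le:
  fixes g :: "real \<Rightarrow> ennreal"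
  assumes [measurable]: "g \<in> borel_measurable borel"
  shows "(\<integral>\<^sup>+\<omega>. ennreal (1 / (\<omega> $ 1)\<^sup>2) * g (\<omega> $ 2 / \<omega> $ 1) \<partial>circle_measure) \<le> 3 * (\<integral>\<^sup>+m. g m \<partial>lborel)"
proof -
  define k where "k t = ennreal (indicator {-pi/2<..<pi/2} t / (cos t)\<^sup>2) * g (tan t)" for t :: real
  have [measurable]: "(tan :: real \<Rightarrow> real) \<in> borel_measurable borel"
    unfolding tan_def by measurable
  have [measurable]: "k \<in> borel_measurable borel"
    unfolding k_def by measurable
  have shift: "(\<integral>\<^sup>+t. k (t - c) \<partial>lborel) = (\<integral>\<^sup>+m. g m \<partial>lborel)" for c
    using nn_integral_real_affine[of k 1 "-c"] nn_integral_tan[of g] by (simp add: k_def)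
  have "(\<integral>\<^sup>+\<omega>. ennreal (1 / (\<omega> $ 1)\<^sup>2) * g (\<omega> $ 2 / \<omega> $ 1) \<partial>circle_measure)
      = (\<integral>\<^sup>+t. indicator {0..<2 * pi} t * (ennreal (1 / (cos t)\<^sup>2) * g (tan t)) \<partial>lborel)"
    by (subst nn_integral_circle) (simp_all add: tan_def)
  also have "\<dots> \<le> (\<integral>\<^sup>+t. k (t - 0) + k (t - pi) + k (t - 2 * pi) \<partial>lborel)"
  proof (rule nn_integral_mono_AE, use AE_cos_nonzero in eventually_elim)
    fix t :: real
    assume c: "cos t \<noteq> 0"
    have "cos (3 * pi / 2) = 0"
      using cos_3over2_pi by (simp add: mult.commute)
    then have "t \<noteq> pi / 2" "t \<noteq> 3 * pi / 2"
      using c cos_pi_half by metis+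
    then have "t < pi / 2 \<or> (pi / 2 < t \<and> t < 3 * pi / 2) \<or> 3 * pi / 2 < t" by linarith
    moreover have "tan (t - pi) = tan t" "tan (t - 2 * pi) = tan t"
      using tan_periodic_pi[of "t - pi"] tan_periodic_pi[of "t - 2 * pi"] by (simp_all add: algebra_simps)
    moreover have "cos (t - 2 * pi) = cos t" by (simp add: cos_diff)
    ultimately have "t \<in> {0..<2 * pi} \<Longrightarrow>
        \<exists>c\<in>{0, pi, 2 * pi}. k (t - c) = ennreal (1 / (cos t)\<^sup>2) * g (tan t)"
      unfolding k_def by (elim disjE) (simp_all add: indicator_def)
    then show "indicator {0..<2 * pi} t * (ennreal (1 / (cos t)\<^sup>2) * g (tan t))
        \<le> k (t - 0) + k (t - pi) + k (t - 2 * pi)"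
      by (cases "t \<in> {0..<2 * pi}") (auto simp: add_increasing add_increasing2)
  qed
  also have "\<dots> = 3 * (\<integral>\<^sup>+m. g m \<partial>lborel)"
  proof -
    have "(3 :: ennreal) = 1 + 1 + 1" by simp
    then show ?thesis
      using shift[of 0] by (simp only: distrib_right mult_1) (simp add: nn_integral_add shift)
  qed
  finally show ?thesis .
qed

lemma nn_integral_translate:
  fixes F :: "real^2 \<Rightarrow> ennreal"
  assumes [measurable]: "F \<in> borel_measurable borel"
  shows "(\<integral>\<^sup>+y. F (x + y) \<partial>lborel) = (\<integral>\<^sup>+y. F y \<partial>lborel)"
  by (subst (2) lborel_distr_plus[symmetric, of x]) (simp add: nn_integral_distr)

text \<open>
  Polar coordinates about \<open>x\<close>, with a signed radius \<open>u\<close>. Substituting first the second coordinate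
  \<open>v = u * \<omega> $ 1\<close> for \<open>u\<close> and then the slope for \<open>\<omega>\<close> leaves only one-dimensional substitutions.
\<close>

lemma nn_integral_polar_le:
  fixes F :: "real^2 \<Rightarrow> ennreal"
  assumes [measurable]: "F \<in> borel_measurable borel"
  shows "(\<integral>\<^sup>+\<omega>. (\<integral>\<^sup>+u. ennreal \<bar>u\<bar> * F (x + u *\<^sub>R perp \<omega>) \<partial>lborel) \<partial>circle_measure) \<le> 3 * (\<integral>\<^sup>+y. F y \<partial>lborel)"
proof -
  define g where "g m = (\<integral>\<^sup>+v. ennreal \<bar>v\<bar> * F (x + vector [- m * v, v]) \<partial>lborel)" for m :: real
  have [measurable]: "g \<in> borel_measurable borel"
    unfolding g_def by measurable
  have "(\<integral>\<^sup>+\<omega>. (\<integral>\<^sup>+u. ennreal \<bar>u\<bar> * F (x + u *\<^sub>R perp \<omega>) \<partial>lborel) \<partial>circle_measure)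
      = (\<integral>\<^sup>+\<omega>. ennreal (1 / (\<omega> $ 1)\<^sup>2) * g (\<omega> $ 2 / \<omega> $ 1) \<partial>circle_measure)"
  proof (rule nn_integral_cong_AE, use AE_circle_fst_nonzero in eventually_elim)
    fix \<omega> :: "real^2"
    assume nz: "\<omega> $ 1 \<noteq> 0"
    define c where "c = \<omega> $ 1"
    have c: "c \<noteq> 0" using nz by (simp add: c_def)
    have "(\<integral>\<^sup>+u. ennreal \<bar>u\<bar> * F (x + u *\<^sub>R perp \<omega>) \<partial>lborel)
        = \<bar>1 / c\<bar> * (\<integral>\<^sup>+v. ennreal \<bar>0 + 1 / c * v\<bar> * F (x + (0 + 1 / c * v) *\<^sub>R perp \<omega>) \<partial>lborel)"
      by (rule nn_integral_real_affine) (use c in auto)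
    also have "\<dots> = \<bar>1 / c\<bar> * (\<integral>\<^sup>+v. ennreal \<bar>1 / c\<bar> * (ennreal \<bar>v\<bar> * F (x + vector [- (\<omega> $ 2 / \<omega> $ 1) * v, v])) \<partial>lborel)"
    proof -
      have "(0 + 1 / c * v) *\<^sub>R perp \<omega> = vector [- (\<omega> $ 2 / \<omega> $ 1) * v, v]" for v
        using c by (simp add: vec_eq_iff forall_2 perp_def c_def)
      moreover have "ennreal \<bar>0 + 1 / c * v\<bar> = ennreal \<bar>1 / c\<bar> * ennreal \<bar>v\<bar>" for v
        by (simp add: ennreal_mult[symmetric] abs_mult abs_divide)
      ultimately show ?thesis by (simp only: mult.assoc)
    qed
    also have "\<dots> = ennreal (1 / c\<^sup>2) * g (\<omega> $ 2 / \<omega> $ 1)"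
    proof -
      have "ennreal (1 / c\<^sup>2) = ennreal \<bar>1 / c\<bar> * ennreal \<bar>1 / c\<bar>"
        by (simp add: ennreal_mult[symmetric] power2_eq_square)
      then show ?thesis
        unfolding g_def by (subst nn_integral_cmult) (simp_all add: mult.assoc)
    qed
    finally show "(\<integral>\<^sup>+u. ennreal \<bar>u\<bar> * F (x + u *\<^sub>R perp \<omega>) \<partial>lborel)
        = ennreal (1 / (\<omega> $ 1)\<^sup>2) * g (\<omega> $ 2 / \<omega> $ 1)"
      by (simp add: c_def)
  qed
  also have "\<dots> \<le> 3 * (\<integral>\<^sup>+m. g m \<partial>lborel)"
    by (rule nn_integral_circle_slope_le) simp
  also have "(\<integral>\<^sup>+m. g m \<partial>lborel)
      = (\<integral>\<^sup>+v. (\<integral>\<^sup>+m. ennreal \<bar>v\<bar> * F (x + vector [- m * v, v]) \<partial>lborel) \<partial>lborel)"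
    unfolding g_def by (rule lborel_pair.Fubini') simp
  also have "\<dots> = (\<integral>\<^sup>+v. (\<integral>\<^sup>+w. F (x + vector [w, v]) \<partial>lborel) \<partial>lborel)"
  proof (rule nn_integral_cong_AE, use AE_lborel_singleton[of "0::real"] in eventually_elim)
    fix v :: real
    assume "v \<noteq> 0"
    then have "(\<integral>\<^sup>+w. F (x + vector [w, v]) \<partial>lborel)
        = \<bar>- v\<bar> * (\<integral>\<^sup>+m. F (x + vector [0 + (- v) * m, v]) \<partial>lborel)"
      by (intro nn_integral_real_affine) auto
    then show "(\<integral>\<^sup>+m. ennreal \<bar>v\<bar> * F (x + vector [- m * v, v]) \<partial>lborel) = (\<integral>\<^sup>+w. F (x + vector [w, v]) \<partial>lborel)"
      by (simp add: nn_integral_cmult mult.commute)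
  qed
  also have "\<dots> = (\<integral>\<^sup>+y. F (x + y) \<partial>lborel)"
    by (subst nn_integral_plane_swap) simp_all
  also have "\<dots> = (\<integral>\<^sup>+y. F y \<partial>lborel)"
    by (rule nn_integral_translate) simp
  finally show ?thesis .
qed

section \<open>The lengths of the arcs cut out by strips and annuli\<close>

text \<open>
  With \<open>z = y / 2\<close>: \<open>sin y = 2 * sin z * cos z \<ge> 2 * z * (cos z)\<^sup>2 = z * (1 + cos y) \<ge> z\<close>, as
  \<open>tan z \<ge> z\<close>.
\<close>

lemma half_le_sin:
  assumes "0 \<le> y" "y \<le> pi / 2"
  shows "y / 2 \<le> sin y"
proof -
  define z where "z = y / 2"
  have z: "0 \<le> z" "z < pi / 2" and y: "y = 2 * z"
    using assms pi_gt_zero unfolding z_def by linarith+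
  have "z * cos z \<le> sin z"
  proof -
    have c: "0 < cos z" using z by (intro cos_gt_zero_pi) auto
    have "0 \<le> tan z" using z by (cases "z = 0") (auto intro!: less_imp_le tan_gt_zero)
    then have "z \<le> tan z" using abs_tan_ge[of z] z by simp
    then show ?thesis using c by (simp add: tan_def field_simps)
  qed
  moreover have "0 \<le> cos z" using z by (intro cos_ge_zero) auto
  ultimately have "z * cos z * cos z \<le> sin z * cos z" by (rule mult_right_mono)
  moreover have "1 / 2 \<le> cos z * cos z"
  proof -
    have "0 \<le> cos (2 * z)" using z y assms by (intro cos_ge_zero) auto
    then show ?thesis by (simp add: cos_double_cos power2_eq_square)
  qed
  then have "z * (1 / 2) \<le> z * (cos z * cos z)" using z by (intro mult_left_mono) auto
  moreover have "sin y = 2 * (sin z * cos z)" by (simp add: y sin_double)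
  ultimately show ?thesis unfolding y by (simp add: mult.assoc)
qed

text \<open>
  Put \<open>\<alpha> = arccos c\<close> and \<open>\<beta> = arccos d\<close>. Writing \<open>d - c\<close> as a product of sines gives
  \<open>d - c \<ge> (\<alpha> + \<beta>) * (\<alpha> - \<beta>) / 8\<close>, and \<open>\<alpha> \<ge> sqrt (1 - c)\<close>. The denominator \<open>sqrt (1 - c)\<close> is the
  source of the exponents \<open>1/2\<close> in the theorem: below \<open>c = a / norm x\<close>, so it is small when \<open>x\<close> lies near the
  circle of radius \<open>a\<close>.
\<close>

lemma arccos_diff_le:
  assumes "0 \<le> c" "c \<le> d" "d \<le> 1"
  shows "arccos c - arccos d \<le> 8 * ((d - c) / sqrt (1 - c))"
proof (cases "c = 1")
  case False
  define \<alpha> \<beta> where "\<alpha> = arccos c" and "\<beta> = arccos d"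
  have cd: "cos \<alpha> = c" "cos \<beta> = d" using assms by (auto simp: \<alpha>_def \<beta>_def)
  have bounds: "0 \<le> \<beta>" "\<beta> \<le> \<alpha>" "\<alpha> \<le> pi / 2" "0 < \<alpha>"
    using assms False arccos_le_pi2[of c] arccos_less_arccos[of c 1]
    by (auto simp: \<alpha>_def \<beta>_def arccos_lbound arccos_le_mono)
  have "\<alpha> * (\<alpha> - \<beta>) / 8 \<le> 2 * ((\<beta> + \<alpha>) / 2 / 2) * ((\<alpha> - \<beta>) / 2 / 2)"
    using mult_right_mono[of \<alpha> "\<beta> + \<alpha>" "\<alpha> - \<beta>"] bounds by (simp add: field_simps)
  also have "\<dots> \<le> 2 * sin ((\<beta> + \<alpha>) / 2) * sin ((\<alpha> - \<beta>) / 2)"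
    using bounds by (intro mult_mono half_le_sin mult_left_mono mult_nonneg_nonneg sin_ge_zero) auto
  also have "\<dots> = d - c" using cos_diff_cos[of \<beta> \<alpha>] cd by simp
  finally have "\<alpha> - \<beta> \<le> 8 * ((d - c) / \<alpha>)" using bounds by (simp add: field_simps)
  also have "(d - c) / \<alpha> \<le> (d - c) / sqrt (1 - c)"
  proof (rule divide_left_mono)
    have "1 - c = 2 * (sin (\<alpha> / 2))\<^sup>2" using cos_double_sin[of "\<alpha> / 2"] cd by simp
    also have "\<dots> \<le> 2 * (\<alpha> / 2)\<^sup>2"
      using bounds sin_x_le_x[of "\<alpha> / 2"] sin_ge_zero[of "\<alpha> / 2"] by (intro mult_left_mono power_mono) auto
    also have "\<dots> \<le> \<alpha>\<^sup>2" by (simp add: power2_eq_square)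
    finally show "sqrt (1 - c) \<le> \<alpha>" using bounds by (intro real_le_lsqrt) auto
    show "0 < \<alpha> * sqrt (1 - c)" using assms False bounds by simp
  qed (use assms in auto)
  finally show ?thesis by (simp add: \<alpha>_def \<beta>_def)
qed (use assms in auto)

text \<open>
  Each \<open>\<tau>\<close> differs by at most \<open>pi / 2\<close> from a multiple \<open>k * pi\<close>, and the distance to it lies between
  \<open>arccos d\<close> and \<open>arccos c\<close>. There are five candidates for \<open>k\<close>, each with two intervals.
\<close>

lemma emeasure_abs_cos_le:
  assumes "0 \<le> c" "c \<le> d" "d \<le> 1"
  shows "emeasure lborel {\<tau>. \<bar>\<tau>\<bar> \<le> 2 * pi \<and> c \<le> \<bar>cos \<tau>\<bar> \<and> \<bar>cos \<tau>\<bar> \<le> d} \<le> ennreal (10 * (arccos c - arccos d))"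
proof -
  define \<alpha> \<beta> where "\<alpha> = arccos c" and "\<beta> = arccos d"
  have le: "\<beta> \<le> \<alpha>" using assms by (simp add: \<alpha>_def \<beta>_def arccos_le_mono)
  define I where "I k = {of_int k * pi + \<beta>..of_int k * pi + \<alpha>} \<union> {of_int k * pi - \<alpha>..of_int k * pi - \<beta>}" for k :: int
  have "{\<tau>. \<bar>\<tau>\<bar> \<le> 2 * pi \<and> c \<le> \<bar>cos \<tau>\<bar> \<and> \<bar>cos \<tau>\<bar> \<le> d} \<subseteq> (\<Union>k\<in>{-2..2}. I k)"
  proof clarify
    fix \<tau> :: real
    assume \<tau>: "\<bar>\<tau>\<bar> \<le> 2 * pi" "c \<le> \<bar>cos \<tau>\<bar>" "\<bar>cos \<tau>\<bar> \<le> d"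
    define k where "k = round (\<tau> / pi)"
    define \<sigma> where "\<sigma> = \<tau> - of_int k * pi"
    have "\<bar>of_int k - \<tau> / pi\<bar> \<le> 1 / 2" unfolding k_def by (rule of_int_round_abs_le)
    then have "\<bar>of_int k - \<tau> / pi\<bar> * pi \<le> 1 / 2 * pi" by (rule mult_right_mono) simp
    moreover have "\<bar>of_int k - \<tau> / pi\<bar> * pi = \<bar>\<sigma>\<bar>"
      by (simp add: \<sigma>_def abs_mult_pos left_diff_distrib abs_minus_commute)
    ultimately have \<sigma>: "\<bar>\<sigma>\<bar> \<le> pi / 2" by simp
    \<comment> \<open>Rounding is monotone, so the bounds for \<open>\<tau> / pi\<close> pass to \<open>k\<close>.\<close>
    have k: "k \<in> {-2..2}"
    proof -
      have "\<tau> / pi \<le> of_int 2" "of_int (-2) \<le> \<tau> / pi" using \<tau>(1) by (auto simp: field_simps abs_le_iff)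
      then have "round (\<tau> / pi) \<le> round (of_int 2 :: real)" "round (of_int (-2) :: real) \<le> round (\<tau> / pi)"
        by (simp_all only: round_mono)
      then show ?thesis unfolding k_def round_of_int by simp
    qed
    have "\<bar>cos \<tau>\<bar> = \<bar>cos \<sigma>\<bar>"
    proof -
      have s: "sin (of_int k * pi) = 0" by (auto simp: sin_zero_iff_int2)
      then have "(cos (of_int k * pi))\<^sup>2 = 1" using sin_cos_squared_add[of "of_int k * pi"] by simp
      then have "\<bar>cos (of_int k * pi)\<bar> = 1" by (auto simp: power2_eq_1_iff)
      then show ?thesis using s by (simp add: \<sigma>_def cos_diff abs_mult)
    qed
    also have "\<dots> = cos \<bar>\<sigma>\<bar>" using cos_ge_zero[of \<sigma>] \<sigma> by (simp add: abs_le_iff)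
    finally have "c \<le> cos \<bar>\<sigma>\<bar>" "cos \<bar>\<sigma>\<bar> \<le> d" using \<tau> by auto
    then have "arccos (cos \<bar>\<sigma>\<bar>) \<le> \<alpha>" "\<beta> \<le> arccos (cos \<bar>\<sigma>\<bar>)"
      using assms unfolding \<alpha>_def \<beta>_def by (auto intro!: arccos_le_arccos)
    moreover have "arccos (cos \<bar>\<sigma>\<bar>) = \<bar>\<sigma>\<bar>" using \<sigma> by (intro arccos_cos) auto
    ultimately have "\<bar>\<sigma>\<bar> \<le> \<alpha>" "\<beta> \<le> \<bar>\<sigma>\<bar>" by simp_all
    then have "\<tau> \<in> I k" unfolding I_def \<sigma>_def by (auto simp: abs_if split: if_splits)
    then show "\<tau> \<in> (\<Union>k\<in>{-2..2}. I k)" using k by blast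
  qed
  then have "emeasure lborel {\<tau>. \<bar>\<tau>\<bar> \<le> 2 * pi \<and> c \<le> \<bar>cos \<tau>\<bar> \<and> \<bar>cos \<tau>\<bar> \<le> d} \<le> emeasure lborel (\<Union>k\<in>{-2..2}. I k)"
    by (rule emeasure_mono) (simp add: I_def)
  also have "\<dots> \<le> (\<Sum>k\<in>{-2..2}. emeasure lborel (I k))"
    by (rule emeasure_subadditive_finite) (auto simp: I_def)
  also have "\<dots> \<le> (\<Sum>k\<in>{-2..2::int}. ennreal (2 * (\<alpha> - \<beta>)))"
  proof (rule sum_mono)
    fix k :: int
    have "emeasure lborel (I k) \<le> ennreal (\<alpha> - \<beta>) + ennreal (\<alpha> - \<beta>)"
      unfolding I_def using le by (intro order_trans[OF emeasure_subadditive]) auto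
    then show "emeasure lborel (I k) \<le> ennreal (2 * (\<alpha> - \<beta>))"
      using le by (simp add: ennreal_plus[symmetric] del: ennreal_plus)
  qed
  also have "\<dots> = ennreal (10 * (\<alpha> - \<beta>))"
    using le by (subst sum_ennreal) simp_all
  finally show ?thesis by (simp add: \<alpha>_def \<beta>_def)
qed

text \<open>
  If \<open>x\<close> has polar angle \<open>\<theta>\<close>, then \<open>x \<bullet> \<omega> = norm x * cos (t - \<theta>)\<close>. The angles \<open>t - \<theta>\<close> range over a part
  of \<open>[-2 * pi, 2 * pi]\<close>; bounding the measure on this larger interval makes a discussion of periodicity
  superfluous. For \<open>norm x < a\<close> the set is empty and the bound trivial.
\<close>

lemma emeasure_circle_strip_le:
  fixes x :: "real^2"
  assumes "x \<noteq> 0" "0 \<le> a" "a \<le> b"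
  defines "c \<equiv> a / norm x" and "d \<equiv> min 1 (b / norm x)"
  shows "emeasure circle_measure ({\<omega>. a \<le> \<bar>x \<bullet> \<omega>\<bar> \<and> \<bar>x \<bullet> \<omega>\<bar> \<le> b} \<inter> sphere 0 1)
       \<le> ennreal (80 * ((d - c) / sqrt (1 - c)))" (is "?L \<le> _")
proof (cases "c \<le> 1")
  case False
  then have "norm x < a" using assms by (simp add: c_def field_simps)
  moreover have "\<bar>x \<bullet> \<omega>\<bar> \<le> norm x" if "\<omega> \<in> sphere 0 1" for \<omega>
    using Cauchy_Schwarz_ineq2[of x \<omega>] that by simp
  ultimately have "{\<omega>. a \<le> \<bar>x \<bullet> \<omega>\<bar> \<and> \<bar>x \<bullet> \<omega>\<bar> \<le> b} \<inter> sphere 0 1 = {}" by fastforce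
  then show ?thesis by (metis emeasure_empty zero_le)
next
  case True
  define r where "r = norm x"
  have r: "r > 0" using assms by (simp add: r_def)
  have "(x $ 1 / r)\<^sup>2 + (x $ 2 / r)\<^sup>2 = 1"
  proof -
    have "r\<^sup>2 = (x $ 1)\<^sup>2 + (x $ 2)\<^sup>2"
      unfolding r_def power2_norm_eq_inner by (simp add: inner_vec_def sum_2 power2_eq_square)
    moreover have "r\<^sup>2 \<noteq> 0" using r by simp
    ultimately show ?thesis by (simp add: power_divide add_divide_distrib[symmetric] del: sum_power2_eq_zero_iff)
  qed
  then obtain \<theta> where \<theta>: "0 \<le> \<theta>" "\<theta> < 2 * pi" "x $ 1 / r = cos \<theta>" "x $ 2 / r = sin \<theta>"
    by (rule sincos_total_2pi)
  have inner: "x \<bullet> vector [cos t, sin t] = r * cos (t - \<theta>)" for t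
    using \<theta>(3,4) r by (simp add: inner_vec_def sum_2 cos_diff field_simps)
  have cd: "0 \<le> c" "c \<le> d" "d \<le> 1"
    using assms True by (auto simp: c_def d_def divide_right_mono)
  let ?Z = "{\<tau>. \<bar>\<tau>\<bar> \<le> 2 * pi \<and> c \<le> \<bar>cos \<tau>\<bar> \<and> \<bar>cos \<tau>\<bar> \<le> d}"
  have "?L = emeasure lborel {t \<in> {0..<2 * pi}. a \<le> \<bar>r * cos (t - \<theta>)\<bar> \<and> \<bar>r * cos (t - \<theta>)\<bar> \<le> b}"
    by (subst emeasure_circle) (simp_all add: inner)
  also have "\<dots> \<le> emeasure lborel ((\<lambda>t. t - \<theta>) -` ?Z)"
  proof (rule emeasure_mono)
    show "{t \<in> {0..<2 * pi}. a \<le> \<bar>r * cos (t - \<theta>)\<bar> \<and> \<bar>r * cos (t - \<theta>)\<bar> \<le> b} \<subseteq> (\<lambda>t. t - \<theta>) -` ?Z"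
      using \<theta> r by (auto simp: c_def d_def r_def[symmetric] abs_mult field_simps)
    show "(\<lambda>t. t - \<theta>) -` ?Z \<in> sets lborel"
      using measurable_sets[of "\<lambda>t. t - \<theta>" borel borel ?Z] by simp
  qed
  also have "\<dots> = emeasure lborel ?Z"
  proof -
    have "emeasure lborel ?Z = emeasure (distr lborel borel ((+) (- \<theta>))) ?Z"
      by (simp add: lborel_distr_plus)
    also have "\<dots> = emeasure lborel ((\<lambda>t. t - \<theta>) -` ?Z)"
      by (subst emeasure_distr) (auto intro!: arg_cong[where f = "emeasure lborel"])
    finally show ?thesis by simp
  qed
  also have "\<dots> \<le> ennreal (10 * (arccos c - arccos d))"
    using cd by (rule emeasure_abs_cos_le)
  also have "\<dots> \<le> ennreal (80 * ((d - c) / sqrt (1 - c)))"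
    using mult_left_mono[OF arccos_diff_le[OF cd], of 10] by (intro ennreal_leI) simp
  finally show ?thesis .
qed

text \<open>
  With \<open>c = a / norm x\<close> and \<open>d = min 1 (b / norm x)\<close> one has \<open>d - c \<le> 1 - c\<close>, hence
  \<open>(d - c) / sqrt (1 - c) \<le> sqrt (d - c)\<close>: near the circle of radius \<open>a\<close> the singularity
  costs a square root.
\<close>

lemma emeasure_circle_annulus_le:
  fixes x :: "real^2"
  assumes ab: "0 < a" "a < b" "b \<le> 2 * a"
  shows "emeasure circle_measure ({\<omega>. x \<bullet> \<omega> \<in> {-b..-a} \<union> {a..b}} \<inter> sphere 0 1)
       \<le> ennreal (160 * sqrt (1 - a / b))"
proof (cases "norm x < a")
  case True
  have "\<bar>x \<bullet> \<omega>\<bar> \<le> norm x" if "\<omega> \<in> sphere 0 1" for \<omega>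
    using Cauchy_Schwarz_ineq2[of x \<omega>] that by simp
  with True have "{\<omega>. x \<bullet> \<omega> \<in> {-b..-a} \<union> {a..b}} \<inter> sphere 0 1 = {}"
    by fastforce
  then show ?thesis by (metis emeasure_empty zero_le)
next
  case False
  define c d where "c = a / norm x" and "d = min 1 (b / norm x)"
  have r: "0 < norm x" "a \<le> norm x" using False ab by auto
  have cd: "0 \<le> c" "c \<le> d" "d \<le> 1"
    using r ab by (auto simp: c_def d_def divide_right_mono)
  have "(d - c) / sqrt (1 - c) \<le> sqrt (d - c)"
  proof (cases "c = 1")
    case False
    then have "0 < sqrt (1 - c)" using cd by simp
    moreover have "sqrt (d - c) * sqrt (d - c) \<le> sqrt (d - c) * sqrt (1 - c)"
      using cd by (intro mult_left_mono) auto
    then have "d - c \<le> sqrt (d - c) * sqrt (1 - c)" using cd by simp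
    ultimately show ?thesis by (simp add: divide_le_eq)
  qed (use cd in auto)
  also have "\<dots> \<le> sqrt (2\<^sup>2 * (1 - a / b))"
  proof (rule real_sqrt_le_mono)
    \<comment> \<open>The hypothesis \<open>b \<le> 2 * a\<close> turns the relative width \<open>(b - a) / a\<close> into \<open>1 - a / b\<close>.\<close>
    have "d - c \<le> (b - a) / norm x" by (simp add: c_def d_def diff_divide_distrib)
    also have "\<dots> \<le> (b - a) / a" using r ab by (intro divide_left_mono) auto
    also have "\<dots> \<le> (b - a) / (b / 2)" using ab by (intro divide_left_mono) auto
    also have "\<dots> = 2 * (1 - a / b)" using ab by (simp add: field_simps)
    also have "\<dots> \<le> 2\<^sup>2 * (1 - a / b)" using ab by (intro mult_right_mono) auto
    finally show "d - c \<le> 2\<^sup>2 * (1 - a / b)" .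
  qed
  also have "\<dots> = 2 * sqrt (1 - a / b)" by (subst real_sqrt_mult) simp
  finally have le: "(d - c) / sqrt (1 - c) \<le> 2 * sqrt (1 - a / b)" .
  have "ennreal (80 * ((d - c) / sqrt (1 - c))) \<le> ennreal (160 * sqrt (1 - a / b))"
    by (rule ennreal_leI, rule order_trans[OF mult_left_mono[OF le, of 80]]) simp_all
  moreover have "{\<omega>. x \<bullet> \<omega> \<in> {-b..-a} \<union> {a..b}} = {\<omega>. a \<le> \<bar>x \<bullet> \<omega>\<bar> \<and> \<bar>x \<bullet> \<omega>\<bar> \<le> b}"
    using ab by (auto simp: abs_if)
  moreover have "x \<noteq> 0" "0 \<le> a" "a \<le> b" using r ab by auto
  note emeasure_circle_strip_le[OF this, folded c_def d_def]
  ultimately show ?thesis by (simp only:)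
qed

text \<open>
  Outside a disc of radius \<open>R > b\<close> the denominator stays away from 0:
  \<open>sqrt (1 - a / norm x) \<ge> sqrt (1 - a / R)\<close>.
\<close>

lemma emeasure_circle_annulus_outside_le:
  fixes x :: "real^2"
  assumes ab: "0 < a" "a < b" "b \<le> 2 * a" and R: "b < R" "R < norm x"
  shows "emeasure circle_measure ({\<omega>. x \<bullet> \<omega> \<in> {-b..-a} \<union> {a..b}} \<inter> sphere 0 1)
       \<le> ennreal (160 * ((a / R) * (1 - a / b) / sqrt (1 - a / R)))"
proof -
  define r where "r = norm x"
  have r: "R < r" "b < r" "0 < R" "0 < r" using R ab by (auto simp: r_def)
  have sq: "0 < sqrt (1 - a / R)" using ab R by simp
  have "(b / r - a / r) / sqrt (1 - a / r) \<le> (2 * (a / R * (1 - a / b))) / sqrt (1 - a / R)"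
  proof (rule frac_le)
    have "b / r - a / r = (b - a) / r" by (simp add: diff_divide_distrib)
    also have "\<dots> \<le> (b - a) / R" using r ab by (intro divide_left_mono) auto
    also have "\<dots> = b / R * (1 - a / b)" using r ab by (simp add: field_simps)
    also have "\<dots> \<le> 2 * a / R * (1 - a / b)"
      using ab r by (intro mult_right_mono divide_right_mono) auto
    finally show "b / r - a / r \<le> 2 * (a / R * (1 - a / b))" by simp
    have "a / r \<le> a / R" using ab r by (intro divide_left_mono) auto
    then show "sqrt (1 - a / R) \<le> sqrt (1 - a / r)" by simp
    show "0 \<le> 2 * (a / R * (1 - a / b))" using ab r by simp
  qed (use sq in auto)
  then have le: "(b / r - a / r) / sqrt (1 - a / r) \<le> 2 * (a / R * (1 - a / b) / sqrt (1 - a / R))"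
    by (simp only: times_divide_eq_right)
  have "ennreal (80 * ((b / r - a / r) / sqrt (1 - a / r)))
      \<le> ennreal (160 * ((a / R) * (1 - a / b) / sqrt (1 - a / R)))"
    by (rule ennreal_leI, rule order_trans[OF mult_left_mono[OF le, of 80]]) simp_all
  moreover have "{\<omega>. x \<bullet> \<omega> \<in> {-b..-a} \<union> {a..b}} = {\<omega>. a \<le> \<bar>x \<bullet> \<omega>\<bar> \<and> \<bar>x \<bullet> \<omega>\<bar> \<le> b}"
    using ab by (auto simp: abs_if)
  moreover have "x \<noteq> 0" "0 \<le> a" "a \<le> b" using r ab by (auto simp: r_def)
  note emeasure_circle_strip_le[OF this, folded r_def]
  moreover have "min 1 (b / r) = b / r" using r ab by simp
  ultimately show ?thesis by (simp only:)
qed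

lemma emeasure_circle_slab_le:
  fixes x :: "real^2"
  assumes "0 < b" "b \<le> R" "R \<le> norm x"
  shows "emeasure circle_measure ({\<omega>. x \<bullet> \<omega> \<in> {-b..b}} \<inter> sphere 0 1) \<le> ennreal (80 * (b / R))"
proof -
  have "0 < norm x" "b \<le> norm x" using assms by linarith+
  then have x: "x \<noteq> 0" "min 1 (b / norm x) = b / norm x" by auto
  have "b / norm x \<le> b / R"
    using assms by (intro divide_left_mono mult_pos_pos) linarith+
  then have "ennreal (80 * (b / norm x)) \<le> ennreal (80 * (b / R))"
    by (intro ennreal_leI) simp
  moreover have "{\<omega>. x \<bullet> \<omega> \<in> {-b..b}} = {\<omega>. 0 \<le> \<bar>x \<bullet> \<omega>\<bar> \<and> \<bar>x \<bullet> \<omega>\<bar> \<le> b}"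
    by (auto simp: abs_le_iff)
  moreover have "emeasure circle_measure ({\<omega>. 0 \<le> \<bar>x \<bullet> \<omega>\<bar> \<and> \<bar>x \<bullet> \<omega>\<bar> \<le> b} \<inter> sphere 0 1)
      \<le> ennreal (80 * (b / norm x))"
    using emeasure_circle_strip_le[of x 0 b] assms x by simp
  ultimately show ?thesis by (simp only:)
qed

section \<open>The transforms of nonnegative functions\<close>

text \<open>
  The \<open>\<sigma>\<close>-algebra of the circle is completed, hence larger than the Borel one. These rules let points of the
  circle be used as vectors of the plane inside product spaces.
\<close>

lemma borel_measurable_circle_dest [measurable_dest]:
  "f \<in> M \<rightarrow>\<^sub>M circle_measure \<Longrightarrow> f \<in> borel_measurable M"
  using measurable_compose[OF _ measurable_ident_circle] by blast

lemma borel_measurable_snd_circle [measurable (raw)]: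
  "f \<in> K \<rightarrow>\<^sub>M M \<Otimes>\<^sub>M circle_measure \<Longrightarrow> (\<lambda>x. snd (f x)) \<in> borel_measurable K"
  by (rule borel_measurable_circle_dest) measurable

lemmas [measurable] = measurable_ident_circle

definition line_point :: "real \<Rightarrow> real^2 \<Rightarrow> real \<Rightarrow> real^2" where
  "line_point s \<omega> t = s *\<^sub>R \<omega> + t *\<^sub>R perp \<omega>"

lemma borel_measurable_line_point [measurable]:
  assumes [measurable]: "f \<in> borel_measurable M" "g \<in> borel_measurable M" "h \<in> borel_measurable M"
  shows "(\<lambda>x. line_point (f x) (g x) (h x)) \<in> borel_measurable M"
  unfolding line_point_def by measurable

lemma line_point_add: "line_point s \<omega> (t + u) = line_point s \<omega> t + u *\<^sub>R perp \<omega>"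
  by (simp add: line_point_def scaleR_add_left)

lemma line_point_inner: "norm \<omega> = 1 \<Longrightarrow> line_point s \<omega> t \<bullet> \<omega> = s"
proof -
  assume "norm \<omega> = 1"
  moreover have "line_point s \<omega> t \<bullet> \<omega> = s * ((\<omega> $ 1)\<^sup>2 + (\<omega> $ 2)\<^sup>2)"
    by (simp add: line_point_def perp_def inner_vec_def sum_2 power2_eq_square algebra_simps)
  ultimately show ?thesis by (simp add: unit_vector_2)
qed

text \<open>
  The two transforms in the extended nonnegative reals. Here no integrability has to be discussed; the
  complex-valued transforms are compared with these through their absolute values.
\<close>

definition nn_radon :: "(real^2 \<Rightarrow> ennreal) \<Rightarrow> real \<times> (real^2) \<Rightarrow> ennreal" where
  "nn_radon f = (\<lambda>(s, \<omega>). \<integral>\<^sup>+t. f (line_point s \<omega> t) \<partial>lborel)"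

definition nn_radon_adj :: "(real \<times> (real^2) \<Rightarrow> ennreal) \<Rightarrow> real^2 \<Rightarrow> ennreal" where
  "nn_radon_adj g x = (\<integral>\<^sup>+\<omega>. g (x \<bullet> \<omega>, \<omega>) \<partial>circle_measure)"

lemma borel_measurable_nn_radon [measurable]:
  assumes [measurable]: "f \<in> borel_measurable borel"
  shows "nn_radon f \<in> borel_measurable (lborel \<Otimes>\<^sub>M circle_measure)"
  unfolding nn_radon_def by measurable

lemma borel_measurable_nn_radon_adj [measurable]:
  assumes [measurable]: "g \<in> borel_measurable (lborel \<Otimes>\<^sub>M circle_measure)"
  shows "nn_radon_adj g \<in> borel_measurable borel"
proof -
  have "nn_radon_adj g \<in> borel_measurable lborel"
    unfolding nn_radon_adj_def by measurable
  then show ?thesis by simp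
qed

text \<open>
  For almost every direction \<open>\<omega>\<close>, \<open>(s, t)\<close> are Cartesian coordinates of the plane. This turns integrals
  over a line and then over all lines into integrals over the plane and then over all directions.
\<close>

lemma nn_integral_rotate_AE:
  fixes F :: "real^2 \<Rightarrow> real^2 \<Rightarrow> ennreal"
  assumes "\<And>\<omega>. \<omega> \<in> sphere 0 1 \<Longrightarrow> F \<omega> \<in> borel_measurable borel"
  shows "(\<integral>\<^sup>+\<omega>. (\<integral>\<^sup>+s. (\<integral>\<^sup>+t. F \<omega> (line_point s \<omega> t) \<partial>lborel) \<partial>lborel) \<partial>circle_measure)
       = (\<integral>\<^sup>+\<omega>. (\<integral>\<^sup>+x. F \<omega> x \<partial>lborel) \<partial>circle_measure)"
proof (rule nn_integral_cong_AE, use AE_circle_fst_nonzero AE_space in eventually_elim)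
  fix \<omega> assume "\<omega> $ 1 \<noteq> 0" "\<omega> \<in> space circle_measure"
  then show "(\<integral>\<^sup>+s. (\<integral>\<^sup>+t. F \<omega> (line_point s \<omega> t) \<partial>lborel) \<partial>lborel) = (\<integral>\<^sup>+x. F \<omega> x \<partial>lborel)"
    using nn_integral_rotate[of "F \<omega>" \<omega>] assms[of \<omega>] by (simp add: line_point_def)
qed

lemma nn_radon_duality:
  assumes [measurable]: "f \<in> borel_measurable borel" "g \<in> borel_measurable (lborel \<Otimes>\<^sub>M circle_measure)"
  shows "(\<integral>\<^sup>+x. f x * nn_radon_adj g x \<partial>lborel)
       = (\<integral>\<^sup>+y. g y * nn_radon f y \<partial>(lborel \<Otimes>\<^sub>M circle_measure))"
proof -
  have "(\<integral>\<^sup>+x. f x * nn_radon_adj g x \<partial>lborel)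
      = (\<integral>\<^sup>+x. (\<integral>\<^sup>+\<omega>. f x * g (x \<bullet> \<omega>, \<omega>) \<partial>circle_measure) \<partial>lborel)"
    unfolding nn_radon_adj_def by (intro nn_integral_cong nn_integral_cmult[symmetric]) measurable
  also have "\<dots> = (\<integral>\<^sup>+\<omega>. (\<integral>\<^sup>+x. f x * g (x \<bullet> \<omega>, \<omega>) \<partial>lborel) \<partial>circle_measure)"
    by (rule lborel_circle.Fubini'[symmetric]) simp
  also have "\<dots> = (\<integral>\<^sup>+\<omega>. (\<integral>\<^sup>+s. (\<integral>\<^sup>+t. f (line_point s \<omega> t) * g (line_point s \<omega> t \<bullet> \<omega>, \<omega>) \<partial>lborel) \<partial>lborel) \<partial>circle_measure)"
    by (rule nn_integral_rotate_AE[symmetric]) simp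
  also have "\<dots> = (\<integral>\<^sup>+\<omega>. (\<integral>\<^sup>+s. g (s, \<omega>) * nn_radon f (s, \<omega>) \<partial>lborel) \<partial>circle_measure)"
  proof (rule nn_integral_cong)
    fix \<omega> assume w: "\<omega> \<in> space circle_measure"
    then have [measurable]: "(\<lambda>s. g (s, \<omega>)) \<in> borel_measurable borel" by simp
    show "(\<integral>\<^sup>+s. (\<integral>\<^sup>+t. f (line_point s \<omega> t) * g (line_point s \<omega> t \<bullet> \<omega>, \<omega>) \<partial>lborel) \<partial>lborel)
        = (\<integral>\<^sup>+s. g (s, \<omega>) * nn_radon f (s, \<omega>) \<partial>lborel)"
      using w by (intro nn_integral_cong) (simp add: line_point_inner nn_radon_def nn_integral_cmult mult.commute[of "f _"])
  qed
  also have "\<dots> = (\<integral>\<^sup>+y. g y * nn_radon f y \<partial>(lborel \<Otimes>\<^sub>M circle_measure))"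
    by (subst lborel_circle.nn_integral_snd[symmetric]) simp_all
  finally show ?thesis .
qed

text \<open>
  The pointwise substitute for the Hardy-Littlewood-Sobolev inequality. By symmetry let \<open>Y \<le> X\<close>, and put
  \<open>w = \<kappa> * \<bar>u\<bar> * X\<^sup>2\<close>. For \<open>w \<le> 1\<close> the left side is at most \<open>X ^ 6\<close>. For \<open>w > 1\<close> use \<open>Z ^ 3 \<le> Z ^ 4 + 1\<close>
  with \<open>Z = \<kappa> * \<bar>u\<bar> * X * Y\<close>: the summand 1 becomes \<open>X ^ 6 / w ^ 3\<close>. Both \<open>X ^ 6\<close> for \<open>w \<le> 1\<close> and
  \<open>X ^ 6 / w ^ 3\<close> for \<open>w > 1\<close> are at most \<open>2 * X ^ 6 / (1 + w\<^sup>2)\<close>, whose integral over \<open>u\<close> is explicit.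
\<close>

lemma cube_mult_cube_le:
  fixes X Y \<kappa> u :: real
  assumes "0 \<le> X" "0 \<le> Y" "0 < \<kappa>"
  shows "X ^ 3 * Y ^ 3 \<le> \<kappa> * \<bar>u\<bar> * X ^ 4 * Y ^ 4
      + 2 * X ^ 6 / (1 + (\<kappa> * X\<^sup>2 * u)\<^sup>2) + 2 * Y ^ 6 / (1 + (\<kappa> * Y\<^sup>2 * u)\<^sup>2)"
proof -
  have *: "X ^ 3 * Y ^ 3 \<le> \<kappa> * \<bar>u\<bar> * X ^ 4 * Y ^ 4 + 2 * X ^ 6 / (1 + (\<kappa> * X\<^sup>2 * u)\<^sup>2)"
    if "0 \<le> Y" "Y \<le> X" for X Y :: real
  proof -
    define v w where "v = \<kappa> * \<bar>u\<bar>" and "w = v * X\<^sup>2"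
    have v: "0 \<le> v" and X: "0 \<le> X" using assms that by (auto simp: v_def)
    have w: "0 \<le> w" using v by (simp add: w_def)
    have sq: "(\<kappa> * X\<^sup>2 * u)\<^sup>2 = w\<^sup>2" by (simp add: w_def v_def power_mult_distrib)
    have p: "0 < 1 + w\<^sup>2" by (simp add: add_pos_nonneg)
    have "X ^ 3 * Y ^ 3 \<le> v * X ^ 4 * Y ^ 4 + 2 * X ^ 6 / (1 + w\<^sup>2)"
    proof (cases "w \<le> 1")
      case True
      have "X ^ 3 * Y ^ 3 \<le> X ^ 3 * X ^ 3"
        using that X by (intro mult_left_mono power_mono) auto
      also have "\<dots> = X ^ 6" by (simp add: power_add[symmetric])
      also have "X ^ 6 \<le> 2 * X ^ 6 / (1 + w\<^sup>2)"
      proof -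
        have "w\<^sup>2 \<le> 1" using True w by (simp add: power_le_one)
        then have "X ^ 6 * (1 + w\<^sup>2) \<le> X ^ 6 * 2" by (intro mult_left_mono) auto
        then show ?thesis using p by (simp add: field_simps)
      qed
      finally show ?thesis using v that X by (simp add: add_increasing)
    next
      case False
      then have v0: "0 < v" using v by (cases "v = 0") (auto simp: w_def)
      define Z where "Z = v * X * Y"
      have Z: "0 \<le> Z" using v that X by (simp add: Z_def)
      have "Z ^ 3 \<le> Z ^ 4 + 1"
      proof (cases "Z \<le> 1")
        case True
        then show ?thesis using Z by (simp add: add_increasing power_le_one)
      next
        case False
        have "Z ^ 3 \<le> Z ^ 4" using False by (intro power_increasing) auto
        then show ?thesis using power_increasing[of 3 4 Z] by simp
      qed
      then have "v ^ 3 * (X ^ 3 * Y ^ 3) \<le> v ^ 3 * (v * X ^ 4 * Y ^ 4) + 1"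
        by (simp add: Z_def power_mult_distrib algebra_simps power_numeral_reduce)
      then have 1: "X ^ 3 * Y ^ 3 \<le> v * X ^ 4 * Y ^ 4 + 1 / v ^ 3"
        using v0 by (simp add: field_simps)
      have "w\<^sup>2 \<le> w ^ 3" "1 \<le> w ^ 3"
        using False power_increasing[of 2 3 w] by (auto intro: one_le_power)
      then have "1 + w\<^sup>2 \<le> 2 * X ^ 6 * v ^ 3"
        by (simp add: w_def power_mult_distrib power_mult[symmetric] mult_ac)
      then have "1 / v ^ 3 \<le> 2 * X ^ 6 / (1 + w\<^sup>2)"
        using v0 p by (simp add: field_simps)
      with 1 show ?thesis by simp
    qed
    then show ?thesis by (simp add: sq v_def)
  qed
  \<comment> \<open>The term of the smaller value is only added to make the bound symmetric.\<close>
  have nn: "0 \<le> 2 * Z ^ 6 / (1 + (\<kappa> * Z\<^sup>2 * u)\<^sup>2)" for Z :: real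
    by simp
  show ?thesis
  proof (cases "Y \<le> X")
    case True
    then show ?thesis using *[of Y X] nn[of Y] assms by linarith
  next
    case False
    then have "Y ^ 3 * X ^ 3 \<le> \<kappa> * \<bar>u\<bar> * Y ^ 4 * X ^ 4 + 2 * Y ^ 6 / (1 + (\<kappa> * Y\<^sup>2 * u)\<^sup>2)"
      using *[of X Y] assms by simp
    moreover have "Y ^ 3 * X ^ 3 = X ^ 3 * Y ^ 3" "\<kappa> * \<bar>u\<bar> * Y ^ 4 * X ^ 4 = \<kappa> * \<bar>u\<bar> * X ^ 4 * Y ^ 4"
      by simp_all
    ultimately show ?thesis using nn[of X] by linarith
  qed
qed

lemma nn_integral_cauchy_kernel_le:
  fixes X \<kappa> :: real
  assumes "0 \<le> X" "0 < \<kappa>"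
  shows "(\<integral>\<^sup>+u. ennreal (2 * X ^ 6 / (1 + (\<kappa> * X\<^sup>2 * (u - t))\<^sup>2)) \<partial>lborel) \<le> ennreal (2 * pi / \<kappa> * X ^ 4)"
proof (cases "X = 0")
  case False
  define c where "c = 1 / (\<kappa> * X\<^sup>2)"
  have c: "0 < c" "\<kappa> * X\<^sup>2 * c = 1" using False assms by (auto simp: c_def)
  have "(\<integral>\<^sup>+u. ennreal (2 * X ^ 6 / (1 + (\<kappa> * X\<^sup>2 * (u - t))\<^sup>2)) \<partial>lborel)
      = \<bar>c\<bar> * (\<integral>\<^sup>+m. ennreal (2 * X ^ 6 / (1 + (\<kappa> * X\<^sup>2 * (t + c * m - t))\<^sup>2)) \<partial>lborel)"
    by (rule nn_integral_real_affine) (use c in auto)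
  also have "(\<lambda>m. ennreal (2 * X ^ 6 / (1 + (\<kappa> * X\<^sup>2 * (t + c * m - t))\<^sup>2)))
      = (\<lambda>m. ennreal (2 * X ^ 6) * ennreal (1 / (1 + m\<^sup>2)))"
  proof
    fix m
    have "\<kappa> * X\<^sup>2 * (t + c * m - t) = (\<kappa> * X\<^sup>2 * c) * m" by (simp add: mult_ac)
    then have "\<kappa> * X\<^sup>2 * (t + c * m - t) = m" unfolding c(2) by simp
    then show "ennreal (2 * X ^ 6 / (1 + (\<kappa> * X\<^sup>2 * (t + c * m - t))\<^sup>2)) = ennreal (2 * X ^ 6) * ennreal (1 / (1 + m\<^sup>2))"
      unfolding \<open>\<kappa> * X\<^sup>2 * (t + c * m - t) = m\<close> by (subst ennreal_mult[symmetric]) simp_all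
  qed
  also have "\<bar>c\<bar> * (\<integral>\<^sup>+m. ennreal (2 * X ^ 6) * ennreal (1 / (1 + m\<^sup>2)) \<partial>(lborel :: real measure))
      = ennreal (c * (2 * X ^ 6 * pi))"
    using c assms
    by (subst nn_integral_cmult, simp, subst nn_integral_inverse_1_plus_square)
       (simp add: ennreal_mult[symmetric])
  also have "c * (2 * X ^ 6 * pi) = 2 * pi / \<kappa> * X ^ 4"
    using False assms by (simp add: c_def field_simps power_numeral_reduce)
  finally show ?thesis by simp
qed simp

text \<open>
  The pointwise inequality, integrated over pairs of points of one line. The two terms that single out one
  of the points have equal integrals by Fubini.
\<close>

lemma nn_integral_cube_square_le:
  fixes f :: "real \<Rightarrow> real"
  assumes [measurable]: "f \<in> borel_measurable borel" and nn: "\<And>t. 0 \<le> f t" and k: "0 < \<kappa>"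
  shows "(\<integral>\<^sup>+t. ennreal (f t ^ 3) \<partial>lborel)\<^sup>2
      \<le> ennreal \<kappa> * (\<integral>\<^sup>+t. ennreal (f t ^ 4) * (\<integral>\<^sup>+u. ennreal \<bar>u\<bar> * ennreal (f (t + u) ^ 4) \<partial>lborel) \<partial>lborel)
        + ennreal (4 * pi / \<kappa>) * (\<integral>\<^sup>+t. ennreal (f t ^ 4) \<partial>lborel)"
proof -
  define Q where "Q t u = ennreal (2 * f t ^ 6 / (1 + (\<kappa> * (f t)\<^sup>2 * (u - t))\<^sup>2))" for t u
  have [measurable]: "(\<lambda>(t, u). Q t u) \<in> borel_measurable (lborel \<Otimes>\<^sub>M lborel)"
    unfolding Q_def by measurable
  have Q: "(\<integral>\<^sup>+u. Q t u \<partial>lborel) \<le> ennreal (2 * pi / \<kappa>) * ennreal (f t ^ 4)" for t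
    using nn_integral_cauchy_kernel_le[OF nn[of t] k, of t] k by (simp add: Q_def ennreal_mult[symmetric] nn)
  have "(\<integral>\<^sup>+t. ennreal (f t ^ 3) \<partial>lborel)\<^sup>2
      = (\<integral>\<^sup>+t. (\<integral>\<^sup>+u. ennreal (f t ^ 3) * ennreal (f u ^ 3) \<partial>lborel) \<partial>lborel)"
    by (simp add: power2_eq_square nn_integral_cmult nn_integral_multc)
  also have "\<dots> \<le> (\<integral>\<^sup>+t. (\<integral>\<^sup>+u. ennreal \<kappa> * (ennreal (f t ^ 4) * (ennreal \<bar>u - t\<bar> * ennreal (f u ^ 4))) + (Q t u + Q u t) \<partial>lborel) \<partial>lborel)"
  proof (intro nn_integral_mono)
    fix t u
    have "(\<kappa> * (f u)\<^sup>2 * (t - u))\<^sup>2 = (\<kappa> * (f u)\<^sup>2 * (u - t))\<^sup>2"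
      by (simp add: power_mult_distrib power2_commute)
    then have "ennreal (f t ^ 3 * f u ^ 3) \<le> ennreal (\<kappa> * (f t ^ 4 * (\<bar>u - t\<bar> * f u ^ 4))
        + (2 * f t ^ 6 / (1 + (\<kappa> * (f t)\<^sup>2 * (u - t))\<^sup>2) + 2 * f u ^ 6 / (1 + (\<kappa> * (f u)\<^sup>2 * (t - u))\<^sup>2)))"
      using cube_mult_cube_le[OF nn[of t] nn[of u] k, of "u - t"] by (intro ennreal_leI) (simp add: mult_ac)
    also have "\<dots> = ennreal \<kappa> * (ennreal (f t ^ 4) * (ennreal \<bar>u - t\<bar> * ennreal (f u ^ 4))) + (Q t u + Q u t)"
      using k nn by (simp add: Q_def ennreal_mult)
    finally show "ennreal (f t ^ 3) * ennreal (f u ^ 3)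
        \<le> ennreal \<kappa> * (ennreal (f t ^ 4) * (ennreal \<bar>u - t\<bar> * ennreal (f u ^ 4))) + (Q t u + Q u t)"
      using nn by (simp add: ennreal_mult[symmetric])
  qed
  also have "\<dots> = ennreal \<kappa> * (\<integral>\<^sup>+t. ennreal (f t ^ 4) * (\<integral>\<^sup>+u. ennreal \<bar>u - t\<bar> * ennreal (f u ^ 4) \<partial>lborel) \<partial>lborel)
      + ((\<integral>\<^sup>+t. (\<integral>\<^sup>+u. Q t u \<partial>lborel) \<partial>lborel) + (\<integral>\<^sup>+t. (\<integral>\<^sup>+u. Q u t \<partial>lborel) \<partial>lborel))"
    by (simp add: nn_integral_add nn_integral_cmult)
  also have "(\<integral>\<^sup>+t. (\<integral>\<^sup>+u. Q u t \<partial>lborel) \<partial>lborel) = (\<integral>\<^sup>+t. (\<integral>\<^sup>+u. Q t u \<partial>lborel) \<partial>lborel)"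
    by (rule lborel_pair.Fubini') simp
  also have "(\<integral>\<^sup>+t. (\<integral>\<^sup>+u. Q t u \<partial>lborel) \<partial>lborel) \<le> ennreal (2 * pi / \<kappa>) * (\<integral>\<^sup>+t. ennreal (f t ^ 4) \<partial>lborel)"
    using nn_integral_mono[OF Q, of lborel "\<lambda>t. t"] by (simp add: nn_integral_cmult)
  also have "(\<lambda>t. ennreal (f t ^ 4) * (\<integral>\<^sup>+u. ennreal \<bar>u - t\<bar> * ennreal (f u ^ 4) \<partial>lborel))
      = (\<lambda>t. ennreal (f t ^ 4) * (\<integral>\<^sup>+u. ennreal \<bar>u\<bar> * ennreal (f (t + u) ^ 4) \<partial>lborel))"
  proof
    fix t
    show "ennreal (f t ^ 4) * (\<integral>\<^sup>+u. ennreal \<bar>u - t\<bar> * ennreal (f u ^ 4) \<partial>lborel)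
        = ennreal (f t ^ 4) * (\<integral>\<^sup>+u. ennreal \<bar>u\<bar> * ennreal (f (t + u) ^ 4) \<partial>lborel)"
      by (subst nn_integral_real_affine[of _ 1 t]) simp_all
  qed
  also have "ennreal (2 * pi / \<kappa>) * (\<integral>\<^sup>+t. ennreal (f t ^ 4) \<partial>lborel) + ennreal (2 * pi / \<kappa>) * (\<integral>\<^sup>+t. ennreal (f t ^ 4) \<partial>lborel)
      = ennreal (4 * pi / \<kappa>) * (\<integral>\<^sup>+t. ennreal (f t ^ 4) \<partial>lborel)"
    using k by (simp add: distrib_right[symmetric] ennreal_plus[symmetric] del: ennreal_plus)
  finally show ?thesis by (simp add: add_mono)
qed

text \<open>
  The bound on one line is integrated over all lines. In the double integral the restriction to \<open>S\<close> can be
  dropped, and polar coordinates about \<open>x\<close> bound it by \<open>3 * N\<^sup>2\<close>. In the single integral the restriction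
  is what produces the factor \<open>A\<close>: by duality, \<open>S\<close> enters through the arc of directions at \<open>x\<close>.
\<close>

lemma nn_radon_cube_square_le:
  fixes h :: "real^2 \<Rightarrow> real" and S :: "real set" and A \<kappa> :: real
  assumes [measurable]: "h \<in> borel_measurable borel" "S \<in> sets borel"
    and nn: "\<And>x. 0 \<le> h x" and k: "0 < \<kappa>"
    and A: "\<And>x. h x \<noteq> 0 \<Longrightarrow> emeasure circle_measure ({\<omega>. x \<bullet> \<omega> \<in> S} \<inter> sphere 0 1) \<le> ennreal A"
  defines "N \<equiv> (\<integral>\<^sup>+x. ennreal (h x ^ 4) \<partial>lborel)"
  shows "(\<integral>\<^sup>+y. indicator S (fst y) * (nn_radon (\<lambda>x. ennreal (h x ^ 3)) y)\<^sup>2 \<partial>(lborel \<Otimes>\<^sub>M circle_measure))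
       \<le> ennreal \<kappa> * (3 * (N * N)) + ennreal (4 * pi / \<kappa>) * (ennreal A * N)"
proof -
  define M where "M x = ennreal (h x ^ 4)" for x
  have [measurable]: "M \<in> borel_measurable borel" unfolding M_def by simp
  define \<Phi> where "\<Phi> \<omega> x = M x * (\<integral>\<^sup>+u. ennreal \<bar>u\<bar> * M (x + u *\<^sub>R perp \<omega>) \<partial>lborel)" for \<omega> x
  have [measurable]: "(\<lambda>(x, \<omega>). \<Phi> \<omega> x) \<in> borel_measurable (lborel \<Otimes>\<^sub>M circle_measure)"
    "(\<lambda>(\<omega>, x). \<Phi> \<omega> x) \<in> borel_measurable (borel \<Otimes>\<^sub>M borel)"
    unfolding \<Phi>_def by measurable
  have [measurable]: "\<Phi> \<omega> \<in> borel_measurable borel" for \<omega>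
    unfolding \<Phi>_def by measurable
  have "(\<integral>\<^sup>+y. indicator S (fst y) * (nn_radon (\<lambda>x. ennreal (h x ^ 3)) y)\<^sup>2 \<partial>(lborel \<Otimes>\<^sub>M circle_measure))
      \<le> (\<integral>\<^sup>+y. ennreal \<kappa> * (\<integral>\<^sup>+t. \<Phi> (snd y) (line_point (fst y) (snd y) t) \<partial>lborel)
            + ennreal (4 * pi / \<kappa>) * (indicator S (fst y) * nn_radon M y) \<partial>(lborel \<Otimes>\<^sub>M circle_measure))"
  proof (rule nn_integral_mono)
    fix y :: "real \<times> (real^2)"
    obtain s \<omega> where y: "y = (s, \<omega>)" by (cases y)
    have "(\<integral>\<^sup>+t. ennreal (h (line_point s \<omega> t) ^ 3) \<partial>lborel)\<^sup>2
        \<le> ennreal \<kappa> * (\<integral>\<^sup>+t. \<Phi> \<omega> (line_point s \<omega> t) \<partial>lborel) + ennreal (4 * pi / \<kappa>) * (\<integral>\<^sup>+t. M (line_point s \<omega> t) \<partial>lborel)"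
      using nn_integral_cube_square_le[of "\<lambda>t. h (line_point s \<omega> t)" \<kappa>] nn k
      by (simp add: \<Phi>_def M_def line_point_add)
    then show "indicator S (fst y) * (nn_radon (\<lambda>x. ennreal (h x ^ 3)) y)\<^sup>2
        \<le> ennreal \<kappa> * (\<integral>\<^sup>+t. \<Phi> (snd y) (line_point (fst y) (snd y) t) \<partial>lborel)
            + ennreal (4 * pi / \<kappa>) * (indicator S (fst y) * nn_radon M y)"
      by (cases "s \<in> S") (simp_all add: y nn_radon_def)
  qed
  also have "\<dots> = ennreal \<kappa> * (\<integral>\<^sup>+y. (\<integral>\<^sup>+t. \<Phi> (snd y) (line_point (fst y) (snd y) t) \<partial>lborel) \<partial>(lborel \<Otimes>\<^sub>M circle_measure))
      + ennreal (4 * pi / \<kappa>) * (\<integral>\<^sup>+y. indicator S (fst y) * nn_radon M y \<partial>(lborel \<Otimes>\<^sub>M circle_measure))"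
    by (simp add: nn_integral_add nn_integral_cmult)
  also have "(\<integral>\<^sup>+y. (\<integral>\<^sup>+t. \<Phi> (snd y) (line_point (fst y) (snd y) t) \<partial>lborel) \<partial>(lborel \<Otimes>\<^sub>M circle_measure)) \<le> 3 * (N * N)"
  proof -
    have "(\<integral>\<^sup>+y. (\<integral>\<^sup>+t. \<Phi> (snd y) (line_point (fst y) (snd y) t) \<partial>lborel) \<partial>(lborel \<Otimes>\<^sub>M circle_measure))
       = (\<integral>\<^sup>+\<omega>. (\<integral>\<^sup>+s. (\<integral>\<^sup>+t. \<Phi> \<omega> (line_point s \<omega> t) \<partial>lborel) \<partial>lborel) \<partial>circle_measure)"
      by (subst lborel_circle.nn_integral_snd[symmetric]) simp_all
    also have "\<dots> = (\<integral>\<^sup>+\<omega>. (\<integral>\<^sup>+x. \<Phi> \<omega> x \<partial>lborel) \<partial>circle_measure)"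
      by (rule nn_integral_rotate_AE) simp
    also have "\<dots> = (\<integral>\<^sup>+x. (\<integral>\<^sup>+\<omega>. \<Phi> \<omega> x \<partial>circle_measure) \<partial>lborel)"
      by (rule lborel_circle.Fubini') simp
    also have "\<dots> \<le> (\<integral>\<^sup>+x. M x * (3 * N) \<partial>lborel)"
    proof (rule nn_integral_mono)
      fix x
      have "(\<integral>\<^sup>+\<omega>. \<Phi> \<omega> x \<partial>circle_measure)
          = M x * (\<integral>\<^sup>+\<omega>. (\<integral>\<^sup>+u. ennreal \<bar>u\<bar> * M (x + u *\<^sub>R perp \<omega>) \<partial>lborel) \<partial>circle_measure)"
        unfolding \<Phi>_def by (rule nn_integral_cmult) measurable
      also have "\<dots> \<le> M x * (3 * N)"
        using nn_integral_polar_le[of M x] by (intro mult_left_mono) (simp_all add: N_def M_def)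
      finally show "(\<integral>\<^sup>+\<omega>. \<Phi> \<omega> x \<partial>circle_measure) \<le> M x * (3 * N)" .
    qed
    also have "\<dots> = 3 * (N * N)"
      by (simp add: nn_integral_multc) (simp add: N_def M_def mult_ac)
    finally show ?thesis .
  qed
  also have "(\<integral>\<^sup>+y. indicator S (fst y) * nn_radon M y \<partial>(lborel \<Otimes>\<^sub>M circle_measure)) \<le> ennreal A * N"
  proof -
    have "(\<integral>\<^sup>+y. indicator S (fst y) * nn_radon M y \<partial>(lborel \<Otimes>\<^sub>M circle_measure))
        = (\<integral>\<^sup>+x. M x * nn_radon_adj (\<lambda>y. indicator S (fst y)) x \<partial>lborel)"
      by (rule nn_radon_duality[symmetric]) simp_all
    also have "\<dots> \<le> (\<integral>\<^sup>+x. M x * ennreal A \<partial>lborel)"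
    proof (rule nn_integral_mono)
      fix x :: "real^2"
      have "{\<omega>. x \<bullet> \<omega> \<in> S} \<inter> sphere 0 1 \<in> sets circle_measure"
        using measurable_sets[OF measurable_ident_circle, of "{\<omega>. x \<bullet> \<omega> \<in> S}"] by simp
      then have "emeasure circle_measure ({\<omega>. x \<bullet> \<omega> \<in> S} \<inter> sphere 0 1)
          = (\<integral>\<^sup>+\<omega>. indicator ({\<omega>. x \<bullet> \<omega> \<in> S} \<inter> sphere 0 1) \<omega> \<partial>circle_measure)"
        by simp
      also have "\<dots> = nn_radon_adj (\<lambda>y. indicator S (fst y)) x"
        unfolding nn_radon_adj_def by (rule nn_integral_cong) (simp add: indicator_def)
      finally have "nn_radon_adj (\<lambda>y. indicator S (fst y)) x = emeasure circle_measure ({\<omega>. x \<bullet> \<omega> \<in> S} \<inter> sphere 0 1)"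
        by simp
      then show "M x * nn_radon_adj (\<lambda>y. indicator S (fst y)) x \<le> M x * ennreal A"
        using A[of x] by (cases "h x = 0") (auto intro: mult_left_mono simp: M_def)
    qed
    also have "\<dots> = ennreal A * N"
      by (simp add: nn_integral_multc) (simp add: N_def M_def mult_ac)
    finally show ?thesis .
  qed
  finally show ?thesis by (simp add: add_mono mult_left_mono)
qed

text \<open>
  The parameter is chosen as \<open>\<kappa> = sqrt (A / N)\<close>, and \<open>3 + 4 * pi \<le> 20\<close>. If \<open>N = 0\<close>, any \<open>\<kappa>\<close> will do.
\<close>

lemma nn_radon_L2_le:
  fixes h :: "real^2 \<Rightarrow> real" and S :: "real set" and A N :: real
  assumes [measurable]: "h \<in> borel_measurable borel" "S \<in> sets borel"
    and nn: "\<And>x. 0 \<le> h x" and A0: "0 < A"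
    and A: "\<And>x. h x \<noteq> 0 \<Longrightarrow> emeasure circle_measure ({\<omega>. x \<bullet> \<omega> \<in> S} \<inter> sphere 0 1) \<le> ennreal A"
    and N: "(\<integral>\<^sup>+x. ennreal (h x ^ 4) \<partial>lborel) = ennreal N" "0 \<le> N"
  shows "(\<integral>\<^sup>+y. indicator S (fst y) * (nn_radon (\<lambda>x. ennreal (h x ^ 3)) y)\<^sup>2 \<partial>(lborel \<Otimes>\<^sub>M circle_measure))
       \<le> ennreal (20 * (sqrt A * N * sqrt N))" (is "?L \<le> _")
proof -
  have le: "?L \<le> ennreal (3 * \<kappa> * N\<^sup>2 + 4 * pi / \<kappa> * A * N)" if "0 < \<kappa>" for \<kappa>
  proof -
    have "ennreal \<kappa> * (3 * (ennreal N * ennreal N)) + ennreal (4 * pi / \<kappa>) * (ennreal A * ennreal N)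
        = ennreal (3 * \<kappa> * N\<^sup>2 + 4 * pi / \<kappa> * A * N)"
    proof -
      have "(3 :: ennreal) = ennreal 3" by simp
      then show ?thesis
        using that N(2) A0 by (simp only: ennreal_mult[symmetric] ennreal_plus[symmetric] zero_le_numeral
          mult_nonneg_nonneg less_imp_le pi_ge_zero divide_nonneg_pos) (simp add: power2_eq_square mult_ac)
    qed
    then show ?thesis
      using nn_radon_cube_square_le[of h S \<kappa> A] nn A that N by simp
  qed
  show ?thesis
  proof (cases "N = 0")
    case True
    then show ?thesis using le[of 1] by simp
  next
    case False
    with N have N0: "0 < N" by simp
    define a n where "a = sqrt A" and "n = sqrt N"
    have an: "0 < a" "0 < n" "A = a\<^sup>2" "N = n\<^sup>2" using A0 N0 by (auto simp: a_def n_def)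
    have "3 * (a / n) * N\<^sup>2 + 4 * pi / (a / n) * A * N = (3 + 4 * pi) * (a * N * n)"
      using an by (simp add: field_simps power2_eq_square)
    also have "\<dots> \<le> 20 * (a * N * n)"
      using pi_less_4 an by (intro mult_right_mono) auto
    finally have "ennreal (3 * (a / n) * N\<^sup>2 + 4 * pi / (a / n) * A * N) \<le> ennreal (20 * (a * N * n))"
      by (rule ennreal_leI)
    moreover have "?L \<le> ennreal (3 * (a / n) * N\<^sup>2 + 4 * pi / (a / n) * A * N)"
      using an by (intro le) simp
    ultimately show ?thesis unfolding a_def n_def by (rule order_trans[rotated])
  qed
qed

lemma SUP_truncated_power:
  fixes w :: ennreal
  shows "w ^ 4 \<le> (SUP n. (min w (of_nat n)) ^ 4 :: ennreal)"
proof (cases "w = top")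
  case True
  have "(of_nat n :: ennreal) \<le> of_nat n ^ 4" for n
  proof -
    have "n \<le> n ^ 4" by (cases "n = 0") (simp_all add: self_le_power)
    then have "(of_nat n :: ennreal) \<le> of_nat (n ^ 4)" by (simp only: of_nat_mono)
    then show ?thesis by simp
  qed
  then have "(SUP n. of_nat n :: ennreal) \<le> (SUP n. of_nat n ^ 4)"
    by (intro SUP_mono) auto
  then show ?thesis by (simp add: True ennreal_SUP_of_nat_eq_top top_unique)
next
  case False
  then obtain n :: nat where "w \<le> of_nat n"
    using ennreal_Ex_less_of_nat[of w] by (auto simp: less_top intro: less_imp_le)
  then have "w ^ 4 = (min w (of_nat n)) ^ 4" by (simp add: min_absorb1)
  then show ?thesis by (auto intro: SUP_upper2)
qed

text \<open>
  Let \<open>w\<close> be the transform of the restriction of \<open>g\<close> to \<open>S\<close>, and \<open>h\<close> its truncation to a bounded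
  function supported in a bounded part of \<open>E\<close>, so that \<open>N = \<integral> h ^ 4\<close> is finite. Then
  \<open>N \<le> \<integral> h ^ 3 * w\<close>, and by duality, Cauchy-Schwarz and the \<open>L\<^sup>2\<close> bound for the transform of \<open>h ^ 3\<close> one gets \<open>N\<^sup>2 \<le> 20 * \<Gamma> * sqrt A * N * sqrt N\<close>. Finiteness of \<open>N\<close> permits
  to divide. Monotone convergence removes the truncation.
\<close>

lemma nn_radon_adj_L4_le:
  fixes g :: "real \<times> (real^2) \<Rightarrow> ennreal" and S :: "real set" and E :: "(real^2) set" and A \<Gamma> :: real
  assumes [measurable]: "g \<in> borel_measurable (lborel \<Otimes>\<^sub>M circle_measure)" "S \<in> sets borel" "E \<in> sets borel"
    and A0: "0 < A"
    and A: "\<And>x. x \<in> E \<Longrightarrow> emeasure circle_measure ({\<omega>. x \<bullet> \<omega> \<in> S} \<inter> sphere 0 1) \<le> ennreal A"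
    and \<Gamma>: "(\<integral>\<^sup>+y. (g y)\<^sup>2 \<partial>(lborel \<Otimes>\<^sub>M circle_measure)) \<le> ennreal \<Gamma>" "0 \<le> \<Gamma>"
  shows "(\<integral>\<^sup>+x. indicator E x * nn_radon_adj (\<lambda>y. indicator S (fst y) * g y) x ^ 4 \<partial>lborel) \<le> ennreal (400 * A * \<Gamma>\<^sup>2)"
proof -
  define w where "w = nn_radon_adj (\<lambda>y. indicator S (fst y) * g y)"
  have [measurable]: "w \<in> borel_measurable borel" unfolding w_def by measurable
  define B where "B n = E \<inter> ball 0 (real n)" for n
  have [measurable]: "B n \<in> sets borel" for n unfolding B_def by simp
  \<comment> \<open>Real-valued, since the bound for \<open>nn_radon\<close> is about cubes of real functions.\<close>
  define h where "h n x = indicator (B n) x * enn2real (min (w x) (of_nat n))" for n x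
  have [measurable]: "h n \<in> borel_measurable borel" for n
    unfolding h_def by measurable
  have h_ennreal: "ennreal (h n x) = indicator (B n) x * min (w x) (of_nat n)" for n x
  proof -
    have "min (w x) (of_nat n) < top" by (simp add: min_less_iff_disj of_nat_less_top)
    then show ?thesis by (simp add: h_def indicator_def)
  qed
  have h_nn: "0 \<le> h n x" for n x by (simp add: h_def)
  have pow: "ennreal (h n x ^ k) = indicator (B n) x * (min (w x) (of_nat n)) ^ k" if "k \<noteq> 0" for n x k
    using that by (simp add: ennreal_power[symmetric] h_nn h_ennreal power_mult_distrib indicator_def)
  have bound: "(\<integral>\<^sup>+x. ennreal (h n x ^ 4) \<partial>lborel) \<le> ennreal (400 * A * \<Gamma>\<^sup>2)" for n
  proof -
    have "(\<integral>\<^sup>+x. ennreal (h n x ^ 4) \<partial>lborel) \<le> (\<integral>\<^sup>+x. of_nat n ^ 4 * indicator (ball 0 (real n)) x \<partial>(lborel :: (real^2) measure))"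
      by (rule nn_integral_mono) (auto simp: pow B_def indicator_def intro: power_mono)
    also have "\<dots> = of_nat n ^ 4 * emeasure lborel (ball (0 :: real^2) (real n))"
      by (subst nn_integral_cmult_indicator) auto
    also have "\<dots> < top"
      using emeasure_bounded_finite[OF bounded_ball, of "0 :: real^2" "real n"]
      by (simp add: ennreal_mult_less_top power_less_top_ennreal of_nat_less_top)
    finally obtain N where N: "(\<integral>\<^sup>+x. ennreal (h n x ^ 4) \<partial>lborel) = ennreal N" "0 \<le> N"
      by (cases "\<integral>\<^sup>+x. ennreal (h n x ^ 4) \<partial>lborel") auto
    define R where "R = nn_radon (\<lambda>x. ennreal (h n x ^ 3))"
    have [measurable]: "R \<in> borel_measurable (lborel \<Otimes>\<^sub>M circle_measure)" unfolding R_def by measurable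
    have "ennreal N \<le> (\<integral>\<^sup>+x. ennreal (h n x ^ 3) * w x \<partial>lborel)"
      unfolding N(1)[symmetric]
    proof (rule nn_integral_mono)
      fix x
      have "ennreal (h n x ^ 4) = ennreal (h n x ^ 3) * ennreal (h n x)"
        using h_nn[of n x] by (simp add: ennreal_mult[symmetric] power_numeral_reduce)
      also have "\<dots> \<le> ennreal (h n x ^ 3) * w x"
        by (intro mult_left_mono) (auto simp: h_ennreal indicator_def)
      finally show "ennreal (h n x ^ 4) \<le> ennreal (h n x ^ 3) * w x" .
    qed
    also have "\<dots> = (\<integral>\<^sup>+y. (indicator S (fst y) * g y) * R y \<partial>(lborel \<Otimes>\<^sub>M circle_measure))"
      unfolding w_def R_def by (rule nn_radon_duality) simp_all
    also have "\<dots> = (\<integral>\<^sup>+y. g y * (indicator S (fst y) * R y) \<partial>(lborel \<Otimes>\<^sub>M circle_measure))"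
      by (simp add: mult_ac)
    finally have "(ennreal N)\<^sup>2 \<le> (\<integral>\<^sup>+y. g y * (indicator S (fst y) * R y) \<partial>(lborel \<Otimes>\<^sub>M circle_measure))\<^sup>2"
      by (rule power_mono) simp
    also have "\<dots> \<le> (\<integral>\<^sup>+y. (g y)\<^sup>2 \<partial>(lborel \<Otimes>\<^sub>M circle_measure))
        * (\<integral>\<^sup>+y. (indicator S (fst y) * R y)\<^sup>2 \<partial>(lborel \<Otimes>\<^sub>M circle_measure))"
      by (rule Cauchy_Schwarz_nn_integral) simp_all
    also have "(\<lambda>y. (indicator S (fst y) * R y)\<^sup>2) = (\<lambda>y. indicator S (fst y) * (R y)\<^sup>2)"
      by (auto simp: indicator_def)
    also have "(\<integral>\<^sup>+y. (g y)\<^sup>2 \<partial>(lborel \<Otimes>\<^sub>M circle_measure)) * (\<integral>\<^sup>+y. indicator S (fst y) * (R y)\<^sup>2 \<partial>(lborel \<Otimes>\<^sub>M circle_measure))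
        \<le> ennreal \<Gamma> * ennreal (20 * (sqrt A * N * sqrt N))"
      unfolding R_def
    proof (intro mult_mono \<Gamma> nn_radon_L2_le)
      show "emeasure circle_measure ({\<omega>. x \<bullet> \<omega> \<in> S} \<inter> sphere 0 1) \<le> ennreal A" if "h n x \<noteq> 0" for x
        using that by (intro A) (auto simp: h_def B_def indicator_def split: if_splits)
    qed (use A0 N h_nn in auto)
    finally have le: "N\<^sup>2 \<le> \<Gamma> * (20 * (sqrt A * N * sqrt N))"
      using N(2) \<Gamma>(2) A0 by (simp add: ennreal_power ennreal_mult[symmetric])
    have "N \<le> 400 * A * \<Gamma>\<^sup>2"
    proof (cases "N = 0")
      case False
      define m where "m = sqrt N"
      have m: "0 < m" "N = m\<^sup>2" using False N by (auto simp: m_def)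
      have "m ^ 3 * m \<le> m ^ 3 * (20 * \<Gamma> * sqrt A)"
        using le m(1) unfolding m_def[symmetric] m(2) by (simp add: power_numeral_reduce mult_ac)
      then have "m \<le> 20 * \<Gamma> * sqrt A" using m by simp
      then have "m\<^sup>2 \<le> (20 * \<Gamma> * sqrt A)\<^sup>2" using m by (intro power_mono) auto
      then show ?thesis using m A0 by (simp add: power_mult_distrib mult_ac)
    qed (use A0 in auto)
    then show ?thesis unfolding N(1) by (rule ennreal_leI)
  qed
  have "(\<integral>\<^sup>+x. indicator E x * w x ^ 4 \<partial>lborel) \<le> (\<integral>\<^sup>+x. (SUP n. ennreal (h n x ^ 4)) \<partial>lborel)"
  proof (rule nn_integral_mono)
    fix x
    show "indicator E x * w x ^ 4 \<le> (SUP n. ennreal (h n x ^ 4))"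
    proof (cases "x \<in> E")
      case True
      obtain m :: nat where m: "norm x < real m" using reals_Archimedean2 by blast
      have "\<exists>k. (min (w x) (of_nat n)) ^ 4 \<le> ennreal (h k x ^ 4)" for n
      proof
        have "x \<in> B (max n m)" using True m by (auto simp: B_def)
        then show "(min (w x) (of_nat n)) ^ 4 \<le> ennreal (h (max n m) x ^ 4)"
          unfolding pow[OF zero_neq_numeral[symmetric]]
          by (auto intro!: power_mono min.mono of_nat_mono simp del: of_nat_max)
      qed
      then have "(SUP n. (min (w x) (of_nat n)) ^ 4) \<le> (SUP n. ennreal (h n x ^ 4))"
        by (intro SUP_mono) auto
      with SUP_truncated_power[of "w x"] show ?thesis using True by (simp add: order_trans)
    qed simp
  qed
  also have "\<dots> = (SUP n. (\<integral>\<^sup>+x. ennreal (h n x ^ 4) \<partial>lborel))"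
  proof (rule nn_integral_monotone_convergence_SUP)
    show "incseq (\<lambda>n x. ennreal (h n x ^ 4))"
    proof (intro incseq_SucI le_funI)
      fix n x
      show "ennreal (h n x ^ 4) \<le> ennreal (h (Suc n) x ^ 4)"
        unfolding pow[OF zero_neq_numeral[symmetric]]
        by (intro mult_mono power_mono min.mono of_nat_mono) (auto simp: B_def indicator_def)
    qed
  qed simp
  also have "\<dots> \<le> ennreal (400 * A * \<Gamma>\<^sup>2)"
    by (rule SUP_least) (rule bound)
  finally show ?thesis by (simp add: w_def)
qed

section \<open>Null sets and the transforms of complex-valued functions\<close>

lemma borel_measurable_complete_AE:
  fixes f g :: "'a \<Rightarrow> 'b::topological_space"
  assumes M: "complete_measure M" and g: "g \<in> borel_measurable M" and ae: "AE x in M. f x = g x"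
  shows "f \<in> borel_measurable M"
proof (rule measurableI)
  fix X :: "'b set" assume X: "X \<in> sets borel"
  have 1: "g -` X \<inter> space M \<in> sets M"
    using measurable_sets[OF g X] .
  have 2: "AE x in M. x \<in> g -` X \<inter> space M \<longleftrightarrow> x \<in> f -` X \<inter> space M"
    using ae by eventually_elim simp
  show "f -` X \<inter> space M \<in> sets M"
    by (rule complete_measure.in_sets_AE[OF M 2 1]) simp
qed simp

lemma borel_measurable_completion_AE:
  fixes f g :: "'a \<Rightarrow> 'b::topological_space"
  assumes "g \<in> borel_measurable M" "AE x in M. f x = g x"
  shows "f \<in> borel_measurable (completion M)"
  using completion.complete_measure_axioms measurable_completion[OF assms(1)] AE_completion[OF assms(2)]
  by (rule borel_measurable_complete_AE)

lemma complete_circle_measure: "complete_measure circle_measure"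
  unfolding circle_measure_def length_measure_def by (rule completion.complete_measure_axioms)

lemma completion_ex_borel_measurable_complex:
  fixes f :: "'a \<Rightarrow> complex"
  assumes [measurable]: "f \<in> borel_measurable (completion M)"
  obtains g where "g \<in> borel_measurable M" "AE x in M. f x = g x"
proof -
  obtain u v :: "'a \<Rightarrow> real" where [measurable]: "u \<in> borel_measurable M" "v \<in> borel_measurable M"
    and uv: "AE x in M. Re (f x) = u x" "AE x in M. Im (f x) = v x"
    using completion_ex_borel_measurable_real[of "\<lambda>x. Re (f x)" M]
      completion_ex_borel_measurable_real[of "\<lambda>x. Im (f x)" M] by auto
  show thesis
  proof
    show "(\<lambda>x. complex_of_real (u x) + \<i> * complex_of_real (v x)) \<in> borel_measurable M" by measurable
    show "AE x in M. f x = complex_of_real (u x) + \<i> * complex_of_real (v x)"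
      using uv by eventually_elim (simp add: complex_eq_iff)
  qed
qed

lemma norm_integral_le_nn_integral:
  fixes f :: "'a \<Rightarrow> 'b::{banach, second_countable_topology}"
  shows "ennreal (norm (integral\<^sup>L M f)) \<le> (\<integral>\<^sup>+x. ennreal (norm (f x)) \<partial>M)"
  by (cases "integrable M f") (auto simp: integral_norm_bound_ennreal not_integrable_integral_eq)

text \<open>
  Duality of the constant 1 with the indicator of a null set \<open>Z\<close> of the cylinder: the right side is
  \<open>\<integral>\<^bsub>Z\<^esub> \<infinity> = 0\<close>, so that almost every curve \<open>\<omega> \<mapsto> (x \<bullet> \<omega>, \<omega>)\<close> meets \<open>Z\<close> in a null set.
\<close>

lemma AE_circle_of_AE_cylinder:
  assumes "AE y in lborel \<Otimes>\<^sub>M circle_measure. P y"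
  shows "AE x in lborel. AE \<omega> in circle_measure. P (x \<bullet> \<omega>, \<omega>)"
proof -
  obtain Z where Z: "{y \<in> space (lborel \<Otimes>\<^sub>M circle_measure). \<not> P y} \<subseteq> Z"
    "Z \<in> null_sets (lborel \<Otimes>\<^sub>M circle_measure)"
    using assms by (auto simp: eventually_ae_filter)
  then have [measurable]: "Z \<in> sets (lborel \<Otimes>\<^sub>M circle_measure)" by auto
  have "(\<integral>\<^sup>+x. nn_radon_adj (indicator Z) x \<partial>lborel)
      = (\<integral>\<^sup>+y. indicator Z y * nn_radon (\<lambda>_. 1) y \<partial>(lborel \<Otimes>\<^sub>M circle_measure))"
    using nn_radon_duality[of "\<lambda>_. 1" "indicator Z"] by simp
  also have "\<dots> = (\<integral>\<^sup>+y. 0 \<partial>((lborel :: real measure) \<Otimes>\<^sub>M circle_measure))"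
  proof (rule nn_integral_cong_AE)
    show "AE y in lborel \<Otimes>\<^sub>M circle_measure. indicator Z y * nn_radon (\<lambda>_. 1) y = 0"
      using AE_not_in[OF Z(2)] by eventually_elim simp
  qed
  finally have "AE x in lborel. nn_radon_adj (indicator Z) x = 0"
    by (simp add: nn_integral_0_iff_AE)
  then show ?thesis
  proof eventually_elim
    case (elim x)
    have "(\<lambda>\<omega>. indicator Z (x \<bullet> \<omega>, \<omega>) :: ennreal) \<in> borel_measurable circle_measure" by measurable
    with elim have "AE \<omega> in circle_measure. indicator Z (x \<bullet> \<omega>, \<omega>) = (0 :: ennreal)"
      by (simp add: nn_radon_adj_def nn_integral_0_iff_AE)
    then show ?case
      using AE_space
    proof eventually_elim
      case (elim \<omega>)
      then have "(x \<bullet> \<omega>, \<omega>) \<in> space (lborel \<Otimes>\<^sub>M circle_measure)" "(x \<bullet> \<omega>, \<omega>) \<notin> Z"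
        by (auto simp: space_pair_measure indicator_def split: if_splits)
      then show ?case using Z(1) by blast
    qed
  qed
qed

text \<open>
  The same with the roles exchanged: almost every line meets a null set of the plane in a null set.
\<close>

lemma AE_line_of_null_sets:
  assumes Z: "Z \<in> null_sets (lborel :: (real^2) measure)"
  shows "AE y in lborel \<Otimes>\<^sub>M circle_measure. AE t in lborel. line_point (fst y) (snd y) t \<notin> Z"
proof -
  have [measurable]: "Z \<in> sets borel" using Z by auto
  have "(\<integral>\<^sup>+y. nn_radon (indicator Z) y \<partial>(lborel \<Otimes>\<^sub>M circle_measure))
      = (\<integral>\<^sup>+x. indicator Z x * nn_radon_adj (\<lambda>_. 1) x \<partial>lborel)"
    using nn_radon_duality[of "indicator Z" "\<lambda>_. 1"] by simp
  also have "\<dots> = (\<integral>\<^sup>+x. 0 \<partial>(lborel :: (real^2) measure))"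
    by (rule nn_integral_cong_AE, use AE_not_in[OF Z] in eventually_elim) simp
  finally have "AE y in lborel \<Otimes>\<^sub>M circle_measure. nn_radon (indicator Z) y = 0"
    by (simp add: nn_integral_0_iff_AE)
  then show ?thesis
  proof eventually_elim
    case (elim y)
    have "(\<lambda>t. indicator Z (line_point (fst y) (snd y) t) :: ennreal) \<in> borel_measurable lborel" by measurable
    with elim have "AE t in lborel. indicator Z (line_point (fst y) (snd y) t) = (0 :: ennreal)"
      by (simp add: nn_radon_def case_prod_beta nn_integral_0_iff_AE)
    then show ?case by eventually_elim (auto simp: indicator_def split: if_splits)
  qed
qed

lemma restrict_space_UNIV: "restrict_space M UNIV = M"
  by (rule measure_eqI) (auto simp: emeasure_restrict_space)

text \<open>
  Integrals of a Lebesgue measurable function over a line are integrals of a Borel version along the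
  parametrisation, provided that the line avoids the exceptional null set almost everywhere.
\<close>

lemma line_measure_cong:
  fixes f f' :: "real^2 \<Rightarrow> complex"
  assumes \<omega>: "norm \<omega> = 1" and f': "f' \<in> borel_measurable borel"
    and Z: "Z \<in> sets borel" "AE t in lborel. line_point s \<omega> t \<notin> Z"
    and eq: "\<And>x. x \<notin> Z \<Longrightarrow> f x = f' x"
  shows "integrable (line_measure s \<omega>) f \<longleftrightarrow> integrable lborel (\<lambda>t. f' (line_point s \<omega> t))"
    and "integral\<^sup>L (line_measure s \<omega>) f = (LINT t|lborel. f' (line_point s \<omega> t))"
proof -
  define L where "L = {x. \<omega> \<bullet> x = s}"
  define D where "D = distr (restrict_space lborel UNIV) (restrict_space borel L) (line_point s \<omega>)"
  have lm: "line_measure s \<omega> = completion D"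
    by (simp add: line_measure_def length_measure_def D_def L_def line_point_def[abs_def])
  have \<gamma>: "line_point s \<omega> \<in> lborel \<rightarrow>\<^sub>M restrict_space borel L"
    using line_point_inner[OF \<omega>] by (intro measurable_restrict_space2) (auto simp: L_def inner_commute)
  have f'D: "f' \<in> borel_measurable (restrict_space borel L)"
    using f' by (rule measurable_restrict_space1)
  have D: "D = distr lborel (restrict_space borel L) (line_point s \<omega>)"
    unfolding D_def restrict_space_UNIV ..
  have "{x \<in> space (restrict_space borel L). x \<notin> Z} = L \<inter> (- Z)" by (auto simp: space_restrict_space)
  also have "\<dots> \<in> sets (restrict_space borel L)" using Z(1) by (auto simp: sets_restrict_space)
  finally have "AE x in D. x \<notin> Z"
    unfolding D by (subst AE_distr_iff[OF \<gamma>]) (use Z in auto)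
  then have ae: "AE x in D. f x = f' x" by eventually_elim (rule eq)
  have f'M: "f' \<in> borel_measurable D" using f'D by (simp add: D)
  have fM: "f \<in> borel_measurable (completion D)"
    using f'M ae by (rule borel_measurable_completion_AE)
  have ae': "AE x in completion D. f x = f' x" using ae by (rule AE_completion)
  have "integrable (completion D) f \<longleftrightarrow> integrable (completion D) f'"
    using fM measurable_completion[OF f'M] ae' by (rule integrable_cong_AE)
  also have "\<dots> \<longleftrightarrow> integrable D f'" using f'M by (rule integrable_completion)
  also have "\<dots> \<longleftrightarrow> integrable lborel (\<lambda>t. f' (line_point s \<omega> t))"
    unfolding D using \<gamma> f'D by (rule integrable_distr_eq)
  finally show "integrable (line_measure s \<omega>) f \<longleftrightarrow> integrable lborel (\<lambda>t. f' (line_point s \<omega> t))"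
    unfolding lm .
  have "integral\<^sup>L (completion D) f = integral\<^sup>L (completion D) f'"
    using fM measurable_completion[OF f'M] ae' by (rule integral_cong_AE)
  also have "\<dots> = integral\<^sup>L D f'" using f'M by (rule integral_completion)
  also have "\<dots> = (LINT t|lborel. f' (line_point s \<omega> t))"
    unfolding D using \<gamma> f'D by (rule integral_distr)
  finally show "integral\<^sup>L (line_measure s \<omega>) f = (LINT t|lborel. f' (line_point s \<omega> t))"
    unfolding lm .
qed

lemma Lp_norm_2_power4:
  assumes "0 \<le> (LINT x|M. norm (f x) powr 2)"
  shows "Lp_norm M 2 f ^ 4 = (LINT x|M. norm (f x) powr 2)\<^sup>2"
proof -
  define I where "I = (LINT x|M. norm (f x) powr 2)"
  have "0 \<le> I" using assms by (simp only: I_def)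
  then have "(I powr (1 / 2)) ^ 4 = I\<^sup>2"
    using power_mult[of "sqrt I" 2 2] by (simp add: powr_half_sqrt)
  then show ?thesis by (simp only: Lp_norm_def I_def)
qed

text \<open>
  A Borel version \<open>G'\<close> of \<open>G\<close> has the same transform almost everywhere, and its absolute value is covered
  by the estimate for nonnegative functions. Finiteness of the integral in that estimate gives integrability along almost
  every curve, the bound on the integral gives the rest.
\<close>

proposition radon_adj_L4:
  fixes G :: "real \<times> (real^2) \<Rightarrow> complex" and S :: "real set" and E :: "(real^2) set" and A :: real
  assumes G: "G \<in> Lp cylinder_measure 2"
    and supp: "AE y in cylinder_measure. fst y \<notin> S \<longrightarrow> G y = 0"
    and [measurable]: "S \<in> sets borel" "E \<in> sets borel"
    and A0: "0 < A"
    and A: "\<And>x. x \<in> E \<Longrightarrow> emeasure circle_measure ({\<omega>. x \<bullet> \<omega> \<in> S} \<inter> sphere 0 1) \<le> ennreal A"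
  shows "AE x in lebesgue. x \<in> E \<longrightarrow> integrable circle_measure (\<lambda>\<omega>. G (x \<bullet> \<omega>, \<omega>))"
    and "radon_adj G \<in> Lp (restrict_space lebesgue E) 4"
    and "(LINT x:E|lebesgue. norm (radon_adj G x) ^ 4) \<le> 400 * A * Lp_norm cylinder_measure 2 G ^ 4"
proof -
  have "G \<in> borel_measurable (completion (lborel \<Otimes>\<^sub>M circle_measure))"
    using G by (simp add: Lp_def cylinder_measure_def)
  then obtain G' where [measurable]: "G' \<in> borel_measurable (lborel \<Otimes>\<^sub>M circle_measure)"
    and GG': "AE y in lborel \<Otimes>\<^sub>M circle_measure. G y = G' y"
    by (rule completion_ex_borel_measurable_complex)
  define \<Gamma> where "\<Gamma> = (LINT y|cylinder_measure. norm (G y) powr 2)"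
  have \<Gamma>0: "0 \<le> \<Gamma>" unfolding \<Gamma>_def by (rule integral_nonneg_AE) simp
  define g where "g y = ennreal (norm (G' y))" for y
  have [measurable]: "g \<in> borel_measurable (lborel \<Otimes>\<^sub>M circle_measure)" unfolding g_def by measurable
  define w where "w = nn_radon_adj (\<lambda>y. indicator S (fst y) * g y)"
  have [measurable]: "w \<in> borel_measurable borel" unfolding w_def by measurable
  have "(\<integral>\<^sup>+y. (g y)\<^sup>2 \<partial>(lborel \<Otimes>\<^sub>M circle_measure)) = (\<integral>\<^sup>+y. ennreal (norm (G y) powr 2) \<partial>cylinder_measure)"
    unfolding cylinder_measure_def nn_integral_completion
    by (rule nn_integral_cong_AE, use GG' in eventually_elim) (simp add: g_def ennreal_power)
  also have "\<dots> = ennreal \<Gamma>"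
    unfolding \<Gamma>_def using G by (intro nn_integral_eq_integral) (auto simp: Lp_def)
  finally have main: "(\<integral>\<^sup>+x. indicator E x * w x ^ 4 \<partial>lborel) \<le> ennreal (400 * A * \<Gamma>\<^sup>2)"
    unfolding w_def using A0 A \<Gamma>0 by (intro nn_radon_adj_L4_le) auto
  have "AE y in lborel \<Otimes>\<^sub>M circle_measure. fst y \<notin> S \<longrightarrow> G y = 0"
    using supp unfolding cylinder_measure_def AE_completion_iff .
  with GG' have "AE y in lborel \<Otimes>\<^sub>M circle_measure. G y = G' y \<and> (fst y \<notin> S \<longrightarrow> G' y = 0)"
    by eventually_elim auto
  then have slice: "AE x in lborel. AE \<omega> in circle_measure.
      G (x \<bullet> \<omega>, \<omega>) = G' (x \<bullet> \<omega>, \<omega>) \<and> (fst (x \<bullet> \<omega>, \<omega>) \<notin> S \<longrightarrow> G' (x \<bullet> \<omega>, \<omega>) = 0)"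
    by (rule AE_circle_of_AE_cylinder)
  have *: "AE x in lborel. radon_adj G x = radon_adj G' x
      \<and> (\<lambda>\<omega>. G (x \<bullet> \<omega>, \<omega>)) \<in> borel_measurable circle_measure
      \<and> w x = (\<integral>\<^sup>+\<omega>. ennreal (norm (G (x \<bullet> \<omega>, \<omega>))) \<partial>circle_measure)"
    using slice
  proof eventually_elim
    case (elim x)
    have m': "(\<lambda>\<omega>. G' (x \<bullet> \<omega>, \<omega>)) \<in> borel_measurable circle_measure" by measurable
    have ae: "AE \<omega> in circle_measure. G (x \<bullet> \<omega>, \<omega>) = G' (x \<bullet> \<omega>, \<omega>)"
      using elim by eventually_elim simp
    have m: "(\<lambda>\<omega>. G (x \<bullet> \<omega>, \<omega>)) \<in> borel_measurable circle_measure"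
      using complete_circle_measure m' ae by (rule borel_measurable_complete_AE)
    have "w x = (\<integral>\<^sup>+\<omega>. ennreal (norm (G (x \<bullet> \<omega>, \<omega>))) \<partial>circle_measure)"
      unfolding w_def nn_radon_adj_def
      by (rule nn_integral_cong_AE, use elim in eventually_elim) (auto simp: g_def indicator_def)
    moreover have "radon_adj G x = radon_adj G' x"
      unfolding radon_adj_def using m m' ae by (rule integral_cong_AE)
    ultimately show ?case using m by simp
  qed
  have [measurable]: "radon_adj G' \<in> borel_measurable borel"
  proof -
    have "radon_adj G' \<in> borel_measurable lborel" unfolding radon_adj_def by measurable
    then show ?thesis by simp
  qed
  have radM: "radon_adj G \<in> borel_measurable lebesgue"
    by (rule borel_measurable_completion_AE[of "radon_adj G'"]) (simp, use * in eventually_elim, simp)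
  have le_w: "AE x in lborel. ennreal (norm (radon_adj G x)) \<le> w x"
    using *
  proof eventually_elim
    case (elim x)
    then show ?case
      using norm_integral_le_nn_integral[of circle_measure "\<lambda>\<omega>. G (x \<bullet> \<omega>, \<omega>)"] by (simp add: radon_adj_def)
  qed
  \<comment> \<open>The integral is finite, hence so is \<open>w\<close> almost everywhere on \<open>E\<close>.\<close>
  have "AE x in lborel. indicator E x * w x ^ 4 \<noteq> \<infinity>"
  proof (rule nn_integral_PInf_AE)
    show "(\<integral>\<^sup>+x. indicator E x * w x ^ 4 \<partial>lborel) \<noteq> \<infinity>"
      using main by (metis ennreal_neq_top infinity_ennreal_def top_unique)
    have "w \<in> borel_measurable lborel" by simp
    then show "(\<lambda>x. indicator E x * w x ^ 4) \<in> borel_measurable lborel" by simp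
  qed
  then have "AE x in lborel. x \<in> E \<longrightarrow> integrable circle_measure (\<lambda>\<omega>. G (x \<bullet> \<omega>, \<omega>))"
    using *
  proof eventually_elim
    case (elim x)
    then show ?case
      by (cases "x \<in> E") (simp_all add: integrable_iff_bounded less_top power_eq_top_ennreal)
  qed
  then show "AE x in lebesgue. x \<in> E \<longrightarrow> integrable circle_measure (\<lambda>\<omega>. G (x \<bullet> \<omega>, \<omega>))"
    by (rule AE_completion)
  have bound: "(\<integral>\<^sup>+x. ennreal (indicator E x * norm (radon_adj G x) ^ 4) \<partial>lebesgue) \<le> ennreal (400 * A * \<Gamma>\<^sup>2)"
  proof -
    have "(\<integral>\<^sup>+x. ennreal (indicator E x * norm (radon_adj G x) ^ 4) \<partial>lborel) \<le> (\<integral>\<^sup>+x. indicator E x * w x ^ 4 \<partial>lborel)"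
    proof (rule nn_integral_mono_AE, use le_w in eventually_elim)
      case (elim x)
      then have "ennreal (norm (radon_adj G x)) ^ 4 \<le> w x ^ 4" by (intro power_mono) auto
      then show ?case by (simp add: indicator_def ennreal_power)
    qed
    then show ?thesis using main by (simp add: nn_integral_completion)
  qed
  have E_leb: "E \<inter> space lebesgue \<in> sets lebesgue" by auto
  have "integrable lebesgue (\<lambda>x. indicator E x * norm (radon_adj G x) ^ 4)"
  proof (rule integrableI_bounded)
    have "(\<integral>\<^sup>+x. ennreal (norm (indicator E x * norm (radon_adj G x) ^ 4)) \<partial>lebesgue) \<le> ennreal (400 * A * \<Gamma>\<^sup>2)"
      using bound by (simp add: abs_mult)
    then show "(\<integral>\<^sup>+x. ennreal (norm (indicator E x * norm (radon_adj G x) ^ 4)) \<partial>lebesgue) < \<infinity>"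
      using ennreal_less_top order_le_less_trans unfolding infinity_ennreal_def by blast
    have "E \<in> sets lebesgue" by simp
    then show "(\<lambda>x. indicator E x * norm (radon_adj G x) ^ 4) \<in> borel_measurable lebesgue"
      using radM by (intro borel_measurable_times borel_measurable_power borel_measurable_indicator) simp_all
  qed
  then have "integrable (restrict_space lebesgue E) (\<lambda>x. norm (radon_adj G x) powr 4)"
    by (simp add: integrable_restrict_space[OF E_leb])
  then show "radon_adj G \<in> Lp (restrict_space lebesgue E) 4"
    using radM by (simp add: Lp_def measurable_restrict_space1)
  have "(LINT x:E|lebesgue. norm (radon_adj G x) ^ 4) \<le> 400 * A * \<Gamma>\<^sup>2"
    unfolding set_lebesgue_integral_def
    by (rule integral_real_bounded) (use bound A0 in simp_all)
  also have "\<Gamma>\<^sup>2 = Lp_norm cylinder_measure 2 G ^ 4"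
    using Lp_norm_2_power4[of cylinder_measure G] \<Gamma>0 by (simp add: \<Gamma>_def)
  finally show "(LINT x:E|lebesgue. norm (radon_adj G x) ^ 4) \<le> 400 * A * Lp_norm cylinder_measure 2 G ^ 4" .
qed

text \<open>
  As for the adjoint, now with \<open>h\<close> the cube root of the absolute value of a Borel version of \<open>f\<close>, so that
  almost everywhere \<open>h ^ 3 = norm f\<close> and \<open>h ^ 4 = norm f powr (4 / 3)\<close>.
\<close>

proposition radon_L2:
  fixes f :: "real^2 \<Rightarrow> complex" and S :: "real set" and E :: "(real^2) set" and A :: real
  assumes f: "f \<in> Lp lebesgue (4/3)"
    and supp: "AE x in lebesgue. x \<notin> E \<longrightarrow> f x = 0"
    and [measurable]: "S \<in> sets borel" "E \<in> sets borel"
    and A0: "0 < A"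
    and A: "\<And>x. x \<in> E \<Longrightarrow> emeasure circle_measure ({\<omega>. x \<bullet> \<omega> \<in> S} \<inter> sphere 0 1) \<le> ennreal A"
  defines "M \<equiv> restrict_space cylinder_measure (S \<times> sphere 0 1)"
  shows "AE (s, \<omega>) in M. integrable (line_measure s \<omega>) f"
    and "radon f \<in> Lp M 2"
    and "Lp_norm M 2 (radon f) \<le> sqrt 20 * A powr (1 / 4) * Lp_norm lebesgue (4/3) f"
proof -
  let ?C = "lborel \<Otimes>\<^sub>M circle_measure"
  have fM: "f \<in> borel_measurable lebesgue" and fI: "integrable lebesgue (\<lambda>x. norm (f x) powr (4/3))"
    using f by (auto simp: Lp_def)
  obtain f\<^sub>0 where [measurable]: "f\<^sub>0 \<in> borel_measurable lborel" and ff\<^sub>0: "AE x in lborel. f x = f\<^sub>0 x"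
    using fM by (rule completion_ex_borel_measurable_complex)
  define f' where "f' x = indicator E x * f\<^sub>0 x" for x
  have f'_lborel: "f' \<in> borel_measurable lborel"
    unfolding f'_def by (intro borel_measurable_times borel_measurable_indicator) auto
  then have [measurable]: "f' \<in> borel_measurable borel" by simp
  have "AE x in lborel. x \<notin> E \<longrightarrow> f x = 0"
    using supp unfolding AE_completion_iff .
  with ff\<^sub>0 have ff': "AE x in lborel. f x = f' x"
    by eventually_elim (auto simp: f'_def indicator_def)
  then obtain Z where Z: "{x. f x \<noteq> f' x} \<subseteq> Z" "Z \<in> null_sets lborel"
    by (auto simp: eventually_ae_filter)
  define h where "h x = norm (f' x) powr (1 / 3)" for x
  have [measurable]: "h \<in> borel_measurable borel" unfolding h_def by measurable
  have h_nn: "0 \<le> h x" for x by (simp add: h_def)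
  have h3: "h x ^ 3 = norm (f' x)" for x
    by (cases "f' x = 0") (simp_all add: h_def powr_power)
  have h4: "h x ^ 4 = norm (f' x) powr (4/3)" for x
    by (cases "f' x = 0") (simp_all add: h_def powr_power)
  define N where "N = (LINT x|lebesgue. norm (f x) powr (4/3))"
  have N0: "0 \<le> N" unfolding N_def by (rule integral_nonneg_AE) simp
  have "(\<integral>\<^sup>+x. ennreal (h x ^ 4) \<partial>lborel) = (\<integral>\<^sup>+x. ennreal (norm (f x) powr (4/3)) \<partial>lebesgue)"
    unfolding nn_integral_completion
    by (rule nn_integral_cong_AE, use ff' in eventually_elim) (simp add: h4)
  also have "\<dots> = ennreal N"
    unfolding N_def using fI by (intro nn_integral_eq_integral) auto
  finally have N: "(\<integral>\<^sup>+x. ennreal (h x ^ 4) \<partial>lborel) = ennreal N" .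
  define W where "W = nn_radon (\<lambda>x. ennreal (norm (f' x)))"
  have [measurable]: "W \<in> borel_measurable ?C" unfolding W_def by measurable
  have main: "(\<integral>\<^sup>+y. indicator S (fst y) * (W y)\<^sup>2 \<partial>?C) \<le> ennreal (20 * (sqrt A * N * sqrt N))"
    unfolding W_def h3[symmetric]
  proof (rule nn_radon_L2_le)
    show "emeasure circle_measure ({\<omega>. x \<bullet> \<omega> \<in> S} \<inter> sphere 0 1) \<le> ennreal A" if "h x \<noteq> 0" for x
      using that by (intro A) (auto simp: h_def f'_def indicator_def split: if_splits)
  qed (use A0 N N0 h_nn in auto)
  define R where "R y = (LINT t|lborel. f' (line_point (fst y) (snd y) t))" for y
  have R_meas: "R \<in> borel_measurable ?C"
    unfolding R_def by measurable
  have lines: "AE y in ?C. (integrable (line_measure (fst y) (snd y)) f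
        \<longleftrightarrow> integrable lborel (\<lambda>t. f' (line_point (fst y) (snd y) t))) \<and> radon f y = R y"
    using AE_line_of_null_sets[OF Z(2)] AE_space
  proof eventually_elim
    case (elim y)
    then have "norm (snd y) = 1" by (auto simp: space_pair_measure)
    moreover have "Z \<in> sets borel" using Z(2) by auto
    moreover have "f x = f' x" if "x \<notin> Z" for x using that Z(1) by auto
    ultimately show ?case
      using line_measure_cong[of "snd y" f' Z "fst y" f] elim(1)
      by (simp add: radon_def case_prod_beta R_def)
  qed
  have \<Omega>: "S \<times> sphere 0 1 \<in> sets ?C"
  proof -
    have "sphere 0 1 \<in> sets circle_measure" using sets.top[of circle_measure] by simp
    then show ?thesis by (intro pair_measureI) auto
  qed
  then have \<Omega>': "(S \<times> sphere 0 1) \<inter> space cylinder_measure \<in> sets cylinder_measure"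
    unfolding cylinder_measure_def by (intro sets.Int) auto
  have "AE y in ?C. indicator S (fst y) * (W y)\<^sup>2 \<noteq> \<infinity>"
  proof (rule nn_integral_PInf_AE)
    show "(\<integral>\<^sup>+y. indicator S (fst y) * (W y)\<^sup>2 \<partial>?C) \<noteq> \<infinity>"
      using main by (metis ennreal_neq_top infinity_ennreal_def top_unique)
  qed simp
  then have "AE y in ?C. y \<in> S \<times> sphere 0 1 \<longrightarrow> integrable (line_measure (fst y) (snd y)) f"
    using lines
  proof eventually_elim
    case (elim y)
    show ?case
    proof
      assume "y \<in> S \<times> sphere 0 1"
      then have "fst y \<in> S" by auto
      with elim have "W y < \<infinity>" by (simp add: less_top power_eq_top_ennreal)
      moreover have "(\<lambda>t. f' (line_point (fst y) (snd y) t)) \<in> borel_measurable lborel" by measurable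
      ultimately have "integrable lborel (\<lambda>t. f' (line_point (fst y) (snd y) t))"
        by (simp add: integrable_iff_bounded W_def nn_radon_def case_prod_beta)
      with elim show "integrable (line_measure (fst y) (snd y)) f" by simp
    qed
  qed
  then show "AE (s, \<omega>) in M. integrable (line_measure s \<omega>) f"
    unfolding M_def AE_restrict_space_iff[OF \<Omega>'] case_prod_beta
    unfolding cylinder_measure_def by (rule AE_completion)
  have rf: "radon f \<in> borel_measurable cylinder_measure"
    unfolding cylinder_measure_def
    by (rule borel_measurable_completion_AE[OF R_meas], use lines in eventually_elim) simp
  then have rfM: "radon f \<in> borel_measurable M"
    unfolding M_def by (rule measurable_restrict_space1)
  have bound: "(\<integral>\<^sup>+y. ennreal (norm (radon f y) powr 2) \<partial>M) \<le> ennreal (20 * (sqrt A * N * sqrt N))"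
  proof -
    have "(\<integral>\<^sup>+y. ennreal (norm (radon f y) powr 2) \<partial>M)
        = (\<integral>\<^sup>+y. ennreal (norm (radon f y) powr 2) * indicator (S \<times> sphere 0 1) y \<partial>?C)"
      unfolding M_def nn_integral_restrict_space[OF \<Omega>'] unfolding cylinder_measure_def nn_integral_completion ..
    also have "\<dots> \<le> (\<integral>\<^sup>+y. indicator S (fst y) * (W y)\<^sup>2 \<partial>?C)"
    proof (rule nn_integral_mono_AE, use lines in eventually_elim)
      case (elim y)
      have "ennreal (norm (radon f y)) \<le> W y"
        using elim norm_integral_le_nn_integral[of lborel "\<lambda>t. f' (line_point (fst y) (snd y) t)"]
        by (simp add: R_def W_def nn_radon_def case_prod_beta)
      then have "(ennreal (norm (radon f y)))\<^sup>2 \<le> (W y)\<^sup>2" by (rule power_mono) simp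
      then show ?case by (auto simp: indicator_def ennreal_power)
    qed
    finally show ?thesis using main by (rule order_trans)
  qed
  have "integrable M (\<lambda>y. norm (radon f y) powr 2)"
  proof (rule integrableI_bounded)
    show "(\<lambda>y. norm (radon f y) powr 2) \<in> borel_measurable M" using rfM by simp
    have "(\<integral>\<^sup>+y. ennreal (norm (norm (radon f y) powr 2)) \<partial>M) \<le> ennreal (20 * (sqrt A * N * sqrt N))"
      using bound by simp
    then show "(\<integral>\<^sup>+y. ennreal (norm (norm (radon f y) powr 2)) \<partial>M) < \<infinity>"
      using ennreal_less_top order_le_less_trans unfolding infinity_ennreal_def by blast
  qed
  with rfM show "radon f \<in> Lp M 2" by (simp add: Lp_def)
  have "(LINT y|M. norm (radon f y) powr 2) \<le> 20 * (sqrt A * N * sqrt N)"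
    by (rule integral_real_bounded) (use bound A0 N0 in simp_all)
  moreover have "0 \<le> (LINT y|M. norm (radon f y) powr 2)" by (rule integral_nonneg_AE) simp
  ultimately have "Lp_norm M 2 (radon f) \<le> (20 * (sqrt A * N * sqrt N)) powr (1 / 2)"
    unfolding Lp_norm_def by (intro powr_mono2) simp_all
  also have "\<dots> = sqrt 20 * A powr (1 / 4) * N powr (3 / 4)"
  proof -
    have "sqrt A * N * sqrt N = A powr (1 / 2) * N powr (3 / 2)"
      using A0 N0 powr_add[of N 1 "1 / 2"] by (simp add: powr_half_sqrt)
    then show ?thesis
      using A0 N0 powr_add[of N "1 / 2" "1 / 4"] by (simp add: powr_mult powr_powr powr_half_sqrt[symmetric])
  qed
  also have "N powr (3 / 4) = Lp_norm lebesgue (4/3) f"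
    by (simp add: Lp_norm_def N_def)
  finally show "Lp_norm M 2 (radon f) \<le> sqrt 20 * A powr (1 / 4) * Lp_norm lebesgue (4/3) f" .
qed

text \<open>
  The constants of the arc bounds are at most \<open>160\<close>, and \<open>400 * 160 = 64000\<close>; the third part only needs
  \<open>sqrt 20 * 80 powr (1 / 4)\<close>. In the second part, \<open>G\<close> is
  integrable along almost every curve also inside the disc of radius \<open>R\<close>: this is the case \<open>S = UNIV\<close>,
  \<open>E = UNIV\<close>, \<open>A = 2 * pi\<close> of \<open>radon_adj_L4\<close>.
\<close>

theorem proposition6p1:
  "\<exists>C::real. C > 0 \<and>
    (\<forall>(a::real) (b::real) (G :: real \<times> (real^2) \<Rightarrow> complex).
       b > a \<and> a > 0 \<and> b / a \<le> 2 \<and> G \<in> Lp cylinder_measure 2 \<and>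
       (AE (s, \<omega>) in cylinder_measure. s \<notin> {-b..-a} \<union> {a..b} \<longrightarrow> G (s, \<omega>) = 0) \<longrightarrow>
       (AE x in lebesgue. integrable circle_measure (\<lambda>\<omega>. G (x \<bullet> \<omega>, \<omega>))) \<and>
       radon_adj G \<in> Lp lebesgue 4 \<and>
       (\<forall>R::real. R > b \<longrightarrow>
          (LINT x:{x. norm x > R}|lebesgue. norm (radon_adj G x) ^ 4)
            \<le> C * ((a / R) * (1 - a / b) / (1 - a / R) powr (1/2)) * Lp_norm cylinder_measure 2 G ^ 4) \<and>
       (LINT x|lebesgue. norm (radon_adj G x) ^ 4)
          \<le> C * (1 - a / b) powr (1/2) * Lp_norm cylinder_measure 2 G ^ 4) \<and>
    (\<forall>(b::real) (R::real) (G :: real \<times> (real^2) \<Rightarrow> complex).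
       R \<ge> b \<and> b > 0 \<and> G \<in> Lp cylinder_measure 2 \<and>
       (AE (s, \<omega>) in cylinder_measure. s \<notin> {-b..b} \<longrightarrow> G (s, \<omega>) = 0) \<longrightarrow>
       (AE x in lebesgue. integrable circle_measure (\<lambda>\<omega>. G (x \<bullet> \<omega>, \<omega>))) \<and>
       radon_adj G \<in> Lp (restrict_space lebesgue {x. norm x > R}) 4 \<and>
       (LINT x:{x. norm x > R}|lebesgue. norm (radon_adj G x) ^ 4)
          \<le> C * (b / R) * Lp_norm cylinder_measure 2 G ^ 4) \<and>
    (\<forall>(b::real) (R::real) (f :: real^2 \<Rightarrow> complex).
       R \<ge> b \<and> b > 0 \<and> f \<in> Lp lebesgue (4/3) \<and>
       (AE x in lebesgue. norm x < R \<longrightarrow> f x = 0) \<longrightarrow>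
       (AE (s, \<omega>) in restrict_space cylinder_measure ({-b..b} \<times> sphere 0 1).
          integrable (line_measure s \<omega>) f) \<and>
       radon f \<in> Lp (restrict_space cylinder_measure ({-b..b} \<times> sphere 0 1)) 2 \<and>
       Lp_norm (restrict_space cylinder_measure ({-b..b} \<times> sphere 0 1)) 2 (radon f)
          \<le> C * (b / R) powr (1/4) * Lp_norm lebesgue (4/3) f)"
proof (intro exI[of _ "64000 :: real"] conjI; (intro allI impI, elim conjE)?)
  show "(0 :: real) < 64000" by simp
next
  fix a b :: real and G :: "real \<times> (real^2) \<Rightarrow> complex"
  assume a: "a < b" "0 < a" "b / a \<le> 2" and G: "G \<in> Lp cylinder_measure 2"
    and supp: "AE (s, \<omega>) in cylinder_measure. s \<notin> {-b..-a} \<union> {a..b} \<longrightarrow> G (s, \<omega>) = 0"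
  have ab: "0 < a" "a < b" "b \<le> 2 * a" using a by (auto simp: field_simps)
  let ?S = "{-b..-a} \<union> {a..b}"
  have supp': "AE y in cylinder_measure. fst y \<notin> ?S \<longrightarrow> G y = 0"
    using supp by (simp add: case_prod_beta)
  have S: "?S \<in> sets borel" by simp
  have A0: "0 < 160 * sqrt (1 - a / b)" using ab by simp
  note plane = radon_adj_L4[OF G supp' S _ A0, of UNIV, OF _ emeasure_circle_annulus_le[OF ab], simplified]
  have outside: "(LINT x:{x. norm x > R}|lebesgue. norm (radon_adj G x) ^ 4)
      \<le> 64000 * ((a / R) * (1 - a / b) / (1 - a / R) powr (1/2)) * Lp_norm cylinder_measure 2 G ^ 4"
    if R: "b < R" for R
  proof -
    have A0: "0 < 160 * ((a / R) * (1 - a / b) / sqrt (1 - a / R))" using ab R by simp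
    have E: "{x :: real^2. norm x > R} \<in> sets borel" by measurable
    have "(LINT x:{x. norm x > R}|lebesgue. norm (radon_adj G x) ^ 4)
        \<le> 400 * (160 * ((a / R) * (1 - a / b) / sqrt (1 - a / R))) * Lp_norm cylinder_measure 2 G ^ 4"
      by (rule radon_adj_L4(3)[OF G supp' S E A0])
         (use emeasure_circle_annulus_outside_le[OF ab R] in simp)
    moreover have "(1 - a / R) powr (1/2) = sqrt (1 - a / R)" using ab R by (simp add: powr_half_sqrt)
    ultimately show ?thesis by simp
  qed
  show "(AE x in lebesgue. integrable circle_measure (\<lambda>\<omega>. G (x \<bullet> \<omega>, \<omega>))) \<and>
       radon_adj G \<in> Lp lebesgue 4 \<and>
       (\<forall>R::real. R > b \<longrightarrow>
          (LINT x:{x. norm x > R}|lebesgue. norm (radon_adj G x) ^ 4)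
            \<le> 64000 * ((a / R) * (1 - a / b) / (1 - a / R) powr (1/2)) * Lp_norm cylinder_measure 2 G ^ 4) \<and>
       (LINT x|lebesgue. norm (radon_adj G x) ^ 4)
          \<le> 64000 * (1 - a / b) powr (1/2) * Lp_norm cylinder_measure 2 G ^ 4"
    using plane outside ab by (simp add: restrict_space_UNIV powr_half_sqrt set_lebesgue_integral_def)
next
  fix b R :: real and G :: "real \<times> (real^2) \<Rightarrow> complex"
  assume R: "b \<le> R" "0 < b" and G: "G \<in> Lp cylinder_measure 2"
    and supp: "AE (s, \<omega>) in cylinder_measure. s \<notin> {-b..b} \<longrightarrow> G (s, \<omega>) = 0"
  have supp': "AE y in cylinder_measure. fst y \<notin> {-b..b} \<longrightarrow> G y = 0"
    using supp by (simp add: case_prod_beta)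
  have S: "{-b..b} \<in> sets borel" by simp
  have E: "{x :: real^2. norm x > R} \<in> sets borel" by measurable
  have A0: "0 < 80 * (b / R)" using R by simp
  have A: "emeasure circle_measure ({\<omega>. x \<bullet> \<omega> \<in> {-b..b}} \<inter> sphere 0 1) \<le> ennreal (80 * (b / R))"
    if "x \<in> {x :: real^2. norm x > R}" for x
    using emeasure_circle_slab_le[of b R x] R that by simp
  have "AE x in lebesgue. x \<in> UNIV \<longrightarrow> integrable circle_measure (\<lambda>\<omega>. G (x \<bullet> \<omega>, \<omega>))"
  proof (rule radon_adj_L4(1)[OF G, of UNIV UNIV "2 * pi"])
    show "emeasure circle_measure ({\<omega>. x \<bullet> \<omega> \<in> UNIV} \<inter> sphere 0 1) \<le> ennreal (2 * pi)" for x :: "real^2"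
      by (simp add: emeasure_circle_space)
  qed simp_all
  then have "AE x in lebesgue. integrable circle_measure (\<lambda>\<omega>. G (x \<bullet> \<omega>, \<omega>))" by simp
  moreover have "radon_adj G \<in> Lp (restrict_space lebesgue {x. norm x > R}) 4"
    using G supp' S E A0 A by (rule radon_adj_L4(2))
  moreover have "(LINT x:{x. norm x > R}|lebesgue. norm (radon_adj G x) ^ 4)
      \<le> 64000 * (b / R) * Lp_norm cylinder_measure 2 G ^ 4"
  proof (rule order_trans)
    show "(LINT x:{x. norm x > R}|lebesgue. norm (radon_adj G x) ^ 4)
        \<le> 400 * (80 * (b / R)) * Lp_norm cylinder_measure 2 G ^ 4"
      using G supp' S E A0 A by (rule radon_adj_L4(3))
    show "400 * (80 * (b / R)) * Lp_norm cylinder_measure 2 G ^ 4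
        \<le> 64000 * (b / R) * Lp_norm cylinder_measure 2 G ^ 4"
      using R by (intro mult_right_mono) (simp_all add: divide_right_mono)
  qed
  ultimately show "(AE x in lebesgue. integrable circle_measure (\<lambda>\<omega>. G (x \<bullet> \<omega>, \<omega>))) \<and>
       radon_adj G \<in> Lp (restrict_space lebesgue {x. norm x > R}) 4 \<and>
       (LINT x:{x. norm x > R}|lebesgue. norm (radon_adj G x) ^ 4)
          \<le> 64000 * (b / R) * Lp_norm cylinder_measure 2 G ^ 4"
    by (intro conjI)
next
  fix b R :: real and f :: "real^2 \<Rightarrow> complex"
  assume R: "b \<le> R" "0 < b" and f: "f \<in> Lp lebesgue (4/3)"
    and supp: "AE x in lebesgue. norm x < R \<longrightarrow> f x = 0"
  let ?M = "restrict_space cylinder_measure ({-b..b} \<times> sphere 0 1)"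
  have supp': "AE x in lebesgue. x \<notin> {x. R \<le> norm x} \<longrightarrow> f x = 0"
    using supp by (simp add: not_le)
  have S: "{-b..b} \<in> sets borel" and E: "{x :: real^2. R \<le> norm x} \<in> sets borel"
    by measurable
  have A0: "0 < 80 * (b / R)" using R by simp
  have A: "emeasure circle_measure ({\<omega>. x \<bullet> \<omega> \<in> {-b..b}} \<inter> sphere 0 1) \<le> ennreal (80 * (b / R))"
    if "x \<in> {x :: real^2. R \<le> norm x}" for x
    using emeasure_circle_slab_le[of b R x] R that by simp
  have "Lp_norm ?M 2 (radon f) \<le> sqrt 20 * (80 * (b / R)) powr (1/4) * Lp_norm lebesgue (4/3) f"
    using f supp' S E A0 A by (rule radon_L2(3))
  also have "\<dots> = sqrt 20 * 80 powr (1/4) * (b / R) powr (1/4) * Lp_norm lebesgue (4/3) f"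
    by (subst powr_mult) simp
  also have "\<dots> \<le> 64000 * (b / R) powr (1/4) * Lp_norm lebesgue (4/3) f"
  proof (intro mult_right_mono)
    have "sqrt 20 \<le> 20" by (rule real_le_lsqrt) auto
    moreover have "80 powr (1/4) \<le> (80 :: real) powr 1" by (rule powr_mono) auto
    ultimately have "sqrt 20 * 80 powr (1/4) \<le> 20 * (80 :: real)" by (intro mult_mono) auto
    then show "sqrt 20 * 80 powr (1/4) \<le> (64000 :: real)" by simp
  qed (simp_all add: Lp_norm_def)
  finally show "(AE (s, \<omega>) in ?M. integrable (line_measure s \<omega>) f) \<and>
       radon f \<in> Lp ?M 2 \<and>
       Lp_norm ?M 2 (radon f) \<le> 64000 * (b / R) powr (1/4) * Lp_norm lebesgue (4/3) f"
    using radon_L2(1,2)[OF f supp' S E A0 A] by blast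
qed

end
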